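(* Let $\{x_t\},\{\widetilde x_t\},\{\bar x_t\},\{w_t\},\{y_t\}$ be generated by the AC-AADMM iteration (defined in the context) with $\mu_d>0$, $\eta_1>0$, $\beta_1=0$, $\beta_t=\beta$ for $t\ge2$ with $\beta\in(0,1-\frac{\sqrt6}{3}]$, $\tau_1=0$, $\tau_2=\mu_d$, $\widetilde\tau_1=0$, $\widetilde\tau_2=1$, $\eta_2=\min\{(1-\beta)\eta_1,\frac1{4L_{K,1}^2/\mu_d+4L_{F,1}}\}$, and for $t\ge3$ $$\eta_t=\min\Big\{\tfrac43\eta_{t-1},\ \frac{\tau_{t-2}+\mu_d}{\tau_{t-1}}\eta_{t-1},\ \frac{\tau_{t-1}}{4\mu_dL_{F,t-1}+4L_{K,t-1}^2}\Big\},$$ $$\tau_t=\tau_{t-1}+\frac{\mu_d}{2}\Big[\alpha+(1-\alpha)\eta_t\cdot\frac{4\mu_dL_{F,t-1}+4L_{K,t-1}^2}{\tau_{t-1}}\Big],\qquad\widetilde\tau_t=\frac{\tau_t}{\mu_d},$$ where $\alpha\in(0,1]$ is an absolute constant. Then for every $t\ge2$, $$\eta_t\ge\frac{3+\alpha(t-3)}{12\widetilde L_{t-1}},\qquad\text{where }\widetilde L_t:=\max\Big\{\frac1{4(1-\beta)\eta_1},\ \frac{L_{K,1}^2}{\mu_d}+L_{F,1},\dots,\frac{L_{K,t}^2}{\mu_d}+L_{F,t}\Big\},$$ and consequently, for every $k\ge1$, $$F(\widehat x_k)+G(\widehat w_k)-F(x^* )-G(w^* )\le\frac{12\widetilde L_k}{6k+\alpha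 k(k-3)}\Big[\frac{\|x_0-x^*\|^2}{\beta}+\eta_2\Big(\frac{5L_{K,1}^2}{2\mu_d}+\frac{5L_{F,1}}{2}-\frac1{2\eta_1}\Big)\|x_1-x_0\|^2\Big],$$ $$\|K\widehat x_k-B\widehat w_k+b\|\le\mu_d\|\widetilde y_k\|\le2\mu_d\|y^*\|+2\sqrt{\frac{12\mu_d\widetilde L_k}{6k+\alpha k(k-3)}\Big[\frac{\|x_0-x^*\|^2}{\beta}+\eta_2\Big(\frac{5L_{K,1}^2}{2\mu_d}+\frac{5L_{F,1}}{2}-\frac1{2\eta_1}\Big)\|x_1-x_0\|^2\Big]}.$$ Here $\widehat x_k=\frac{\sum_{t=1}^k\eta_{t+1}x_t}{\sum_{t=1}^k\eta_{t+1}}$, $\widehat w_k=\frac{\sum_{t=1}^k\eta_{t+1}w_t}{\sum_{t=1}^k\eta_{t+1}}$ and $$\widetilde y_k=\frac{\sum_{t=1}^{k-1}\big(\eta_{t+1}(\mu_d+\tau_t)-\eta_{t+2}\tau_{t+1}\big)y_t+\eta_{k+1}(\mu_d+\tau_k)y_k}{\mu_d\sum_{t=1}^k\eta_{t+1}}.$$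
   Context: Setting: $X\subseteq\mathbb{R}^{n_1}$ and $W\subseteq\mathbb{R}^{n_2}$ are nonempty closed convex sets, $b\in\mathbb{R}^m$, $K\in\mathbb{R}^{m\times n_1}$, $B\in\mathbb{R}^{m\times n_2}$, $G:W\to\mathbb{R}$ is proper, lower semicontinuous, convex, and $F:X\to\mathbb{R}$ is a differentiable convex function satisfying, for some $L_F>0$ and all $x,y\in X$, $\frac1{2L_F}\|\nabla F(x)-\nabla F(y)\|^2\le F(y)-F(x)-\langle\nabla F(x),y-x\rangle\le\frac{L_F}{2}\|x-y\|^2$. Norms are Euclidean. The problem is $\min_{x\in X,w\in W}\{F(x)+G(w):Bw-Kx=b\}$. It is assumed that it has an optimal solution $(x^*,w^* )\in X\times W$ together with $y^*\in\mathbb{R}^m$ such that $(x^*,w^*,y^* )$ is a saddle point of $\min_{x\in X,w\in W}\max_{y\in\mathbb{R}^m}F(x)+G(w)+\langle Kx-Bw+b,y\rangle$. AC-AADMM iteration: given $x_0=\bar x_0=\widetilde x_0\in X$, $\mu_d>0$ and parameters $\beta_t\in[0,1)$, $\eta_t$, $\tau_t$, $\widetilde\tau_t$, let $w_0\in\arg\min_{w\in W}\{G(w)+\frac1{2\mu_d}\|Bw-Kx_0-b\|^2\}$, $y_0=(Kx_0-Bw_0+b)/\mu_d$, and for $t=1,2,\dots$ - $x_t=\arg\min_{x\in X}\{\eta_t\langle K^\top y_{t-1}+\nabla F(\widetilde x_{t-1}),x\rangle+\frac12\|\bar x_{t-1}-x\|^2\}$, - $\bar x_t=(1-\beta_t)\bar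 x_{t-1}+\beta_tx_t$, - $\widetilde x_t=(x_t+\widetilde\tau_t\widetilde x_{t-1})/(1+\widetilde\tau_t)$, - $w_t\in\arg\min_{w\in W}\{G(w)+(\tau_t+\mu_d)^{-1}(-\tau_t\langle y_{t-1},Bw\rangle+\frac12\|Bw-Kx_t-b\|^2)\}$, - $y_t=[\tau_ty_{t-1}-(Bw_t-Kx_t-b)]/(\tau_t+\mu_d)$. The minimizers defining $w_t$ are assumed to exist. Local estimates: $L_{K,t}=\frac{\|K^\top(y_t-y_{t-1})\|}{\|y_t-y_{t-1}\|}$ for $t\ge1$; $L_{F,1}=\frac{\|\nabla F(\widetilde x_1)-\nabla F(\widetilde x_0)\|}{\|\widetilde x_1-\widetilde x_0\|}$; $L_{F,t}=\frac{\|\nabla F(\widetilde x_t)-\nabla F(\widetilde x_{t-1})\|^2}{2[F(\widetilde x_{t-1})-F(\widetilde x_t)-\langle\nabla F(\widetilde x_t),\widetilde x_{t-1}-\widetilde x_t\rangle]}$ for $t\ge2$. Conventions: $0/0=0$ and $a/0=+\infty$ for $a>0$.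
   Formalization: In both final bounds the bracket [‖x₀−x*‖²/β+η₂(…)‖x₁−x₀‖²] is replaced by its maximum with 0: when it is negative the square root is undefined and the printed bound on F+G can fail; when it is nonnegative the bounds are as printed. *)

theory Defs
  imports "HOL-Analysis.Analysis"
begin

definition lsc_on :: "'a::topological_space set \<Rightarrow> ('a \<Rightarrow> real) \<Rightarrow> bool" where
  "lsc_on S g \<longleftrightarrow> (\<forall>x\<in>S. \<forall>a. a < g x \<longrightarrow> (\<forall>\<^sub>F z in at x within S. a < g z))"

text \<open>
  The function \<open>F\<close> lives on \<open>X\<close>, so differentiability is taken within \<open>X\<close>. If \<open>X\<close> has empty
  interior the gradient is not determined by \<open>F\<close>; \<open>gradF\<close> is then any admissible choice.
\<close>

definition gradient_on :: "'a::real_inner set \<Rightarrow> ('a \<Rightarrow> real) \<Rightarrow> ('a \<Rightarrow> 'a) \<Rightarrow> bool" where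
  "gradient_on X F gradF \<longleftrightarrow>
     (\<forall>x\<in>X. (F has_derivative (\<lambda>h. gradF x \<bullet> h)) (at x within X))"

definition smooth_ineq_on ::
    "'a::real_inner set \<Rightarrow> ('a \<Rightarrow> real) \<Rightarrow> ('a \<Rightarrow> 'a) \<Rightarrow> real \<Rightarrow> bool" where
  "smooth_ineq_on X F gradF L \<longleftrightarrow>
     (\<forall>x\<in>X. \<forall>y\<in>X.
        1 / (2 * L) * (norm (gradF x - gradF y))\<^sup>2 \<le> F y - F x - gradF x \<bullet> (y - x) \<and>
        F y - F x - gradF x \<bullet> (y - x) \<le> L / 2 * (norm (x - y))\<^sup>2)"

definition optimal_solution ::
    "(real^'n) set \<Rightarrow> (real^'p) set \<Rightarrow> (real^'n \<Rightarrow> real) \<Rightarrow> (real^'p \<Rightarrow> real) \<Rightarrow>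
     real^'n^'m \<Rightarrow> real^'p^'m \<Rightarrow> real^'m \<Rightarrow> real^'n \<Rightarrow> real^'p \<Rightarrow> bool" where
  "optimal_solution X W F G K B b xs ws \<longleftrightarrow>
     is_arg_min (\<lambda>(x, w). F x + G w)
       (\<lambda>(x, w). x \<in> X \<and> w \<in> W \<and> B *v w - K *v x = b) (xs, ws)"

definition lagrangian ::
    "(real^'n \<Rightarrow> real) \<Rightarrow> (real^'p \<Rightarrow> real) \<Rightarrow> real^'n^'m \<Rightarrow> real^'p^'m \<Rightarrow> real^'m \<Rightarrow>
     real^'n \<Rightarrow> real^'p \<Rightarrow> real^'m \<Rightarrow> real" where
  "lagrangian F G K B b x w y = F x + G w + (K *v x - B *v w + b) \<bullet> y"

definition saddle_point ::
    "(real^'n) set \<Rightarrow> (real^'p) set \<Rightarrow> (real^'n \<Rightarrow> real) \<Rightarrow> (real^'p \<Rightarrow> real) \<Rightarrow>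
     real^'n^'m \<Rightarrow> real^'p^'m \<Rightarrow> real^'m \<Rightarrow> real^'n \<Rightarrow> real^'p \<Rightarrow> real^'m \<Rightarrow> bool" where
  "saddle_point X W F G K B b xs ws ys \<longleftrightarrow>
     xs \<in> X \<and> ws \<in> W \<and>
     (\<forall>y. lagrangian F G K B b xs ws y \<le> lagrangian F G K B b xs ws ys) \<and>
     (\<forall>x\<in>X. \<forall>w\<in>W. lagrangian F G K B b xs ws ys \<le> lagrangian F G K B b x w ys)"

text \<open>
  Parameter sequences: \<open>\<mu>\<close> is \<open>\<mu>\<^sub>d\<close>, and \<open>bt\<close>, \<open>\<eta>\<close>, \<open>\<tau>\<close>, \<open>tt\<close> are \<open>\<beta>\<^sub>t\<close>, \<open>\<eta>\<^sub>t\<close>, \<open>\<tau>\<^sub>t\<close> and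
  the one written \<open>\<tau>\<^sub>t\<close> with a tilde (only indices \<open>t \<ge> 1\<close> matter). Iterates: \<open>xbar\<close> is \<open>x\<close>
  with a bar and \<open>xt\<close> is \<open>x\<close> with a tilde.
\<close>

definition aadmm_iteration ::
    "(real^'n) set \<Rightarrow> (real^'p) set \<Rightarrow> (real^'n \<Rightarrow> real^'n) \<Rightarrow> (real^'p \<Rightarrow> real) \<Rightarrow>
     real^'n^'m \<Rightarrow> real^'p^'m \<Rightarrow> real^'m \<Rightarrow>
     real \<Rightarrow> (nat \<Rightarrow> real) \<Rightarrow> (nat \<Rightarrow> real) \<Rightarrow> (nat \<Rightarrow> real) \<Rightarrow> (nat \<Rightarrow> real) \<Rightarrow>
     (nat \<Rightarrow> real^'n) \<Rightarrow> (nat \<Rightarrow> real^'n) \<Rightarrow> (nat \<Rightarrow> real^'n) \<Rightarrow>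
     (nat \<Rightarrow> real^'p) \<Rightarrow> (nat \<Rightarrow> real^'m) \<Rightarrow> bool" where
  "aadmm_iteration X W gradF G K B b \<mu> bt \<eta> \<tau> tt x xbar xt w y \<longleftrightarrow>
     x 0 \<in> X \<and> xbar 0 = x 0 \<and> xt 0 = x 0 \<and>
     is_arg_min (\<lambda>v. G v + 1 / (2 * \<mu>) * (norm (B *v v - K *v x 0 - b))\<^sup>2) (\<lambda>v. v \<in> W) (w 0) \<and>
     y 0 = (1 / \<mu>) *\<^sub>R (K *v x 0 - B *v w 0 + b) \<and>
     (\<forall>t\<ge>1.
        is_arg_min
          (\<lambda>u. \<eta> t * ((transpose K *v y (t - 1) + gradF (xt (t - 1))) \<bullet> u)
                + 1 / 2 * (norm (xbar (t - 1) - u))\<^sup>2)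
          (\<lambda>u. u \<in> X) (x t) \<and>
        xbar t = (1 - bt t) *\<^sub>R xbar (t - 1) + bt t *\<^sub>R x t \<and>
        xt t = (1 / (1 + tt t)) *\<^sub>R (x t + tt t *\<^sub>R xt (t - 1)) \<and>
        is_arg_min
          (\<lambda>v. G v + 1 / (\<tau> t + \<mu>) *
                 (- \<tau> t * (y (t - 1) \<bullet> (B *v v)) + 1 / 2 * (norm (B *v v - K *v x t - b))\<^sup>2))
          (\<lambda>v. v \<in> W) (w t) \<and>
        y t = (1 / (\<tau> t + \<mu>)) *\<^sub>R (\<tau> t *\<^sub>R y (t - 1) - (B *v w t - K *v x t - b)))"

text \<open>
  Real division gives \<open>0 / 0 = 0\<close>. The value \<open>+\<infinity>\<close> prescribed for \<open>a / 0\<close> with \<open>a > 0\<close> is never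
  taken by the local estimates; this is what \<open>ereal_LK_est\<close>, \<open>ereal_LF_est_1\<close> and
  \<open>ereal_LF_est\<close> below record, division on \<open>ereal\<close> obeying exactly these two conventions.
\<close>

definition LK_est :: "real^'n^'m \<Rightarrow> (nat \<Rightarrow> real^'m) \<Rightarrow> nat \<Rightarrow> real" where
  "LK_est K y t = norm (transpose K *v (y t - y (t - 1))) / norm (y t - y (t - 1))"

definition LF_est ::
    "('a::real_inner \<Rightarrow> real) \<Rightarrow> ('a \<Rightarrow> 'a) \<Rightarrow> (nat \<Rightarrow> 'a) \<Rightarrow> nat \<Rightarrow> real" where
  "LF_est F gradF xt t =
     (if t = 1 then norm (gradF (xt 1) - gradF (xt 0)) / norm (xt 1 - xt 0)
      else (norm (gradF (xt t) - gradF (xt (t - 1))))\<^sup>2 /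
           (2 * (F (xt (t - 1)) - F (xt t) - gradF (xt t) \<bullet> (xt (t - 1) - xt t))))"

lemma ereal_div_conventions:
  "ereal 0 / ereal 0 = 0" "0 < a \<Longrightarrow> ereal a / ereal 0 = \<infinity>"
  by (auto simp: divide_ereal_def simp flip: zero_ereal_def)

lemma ereal_divide_if_zero:
  "(d = 0 \<Longrightarrow> a = 0) \<Longrightarrow> ereal (a / d) = ereal a / ereal d"
  by (cases "d = 0") (auto simp: ereal_div_conventions zero_ereal_def)

lemma ereal_LK_est:
  "ereal (LK_est K y t) =
     ereal (norm (transpose K *v (y t - y (t - 1)))) / ereal (norm (y t - y (t - 1)))"
  unfolding LK_est_def by (rule ereal_divide_if_zero) auto

lemma ereal_LF_est_1:
  "ereal (LF_est F gradF xt 1) =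
     ereal (norm (gradF (xt 1) - gradF (xt 0))) / ereal (norm (xt 1 - xt 0))"
  unfolding LF_est_def by (subst if_P[OF refl], rule ereal_divide_if_zero) auto

lemma ereal_LF_est:
  assumes "smooth_ineq_on X F gradF L" "L > 0" "xt t \<in> X" "xt (t - 1) \<in> X" "t \<ge> 2"
  shows "ereal (LF_est F gradF xt t) =
     ereal ((norm (gradF (xt t) - gradF (xt (t - 1))))\<^sup>2) /
     ereal (2 * (F (xt (t - 1)) - F (xt t) - gradF (xt t) \<bullet> (xt (t - 1) - xt t)))"
proof -
  have le: "1 / (2 * L) * (norm (gradF (xt t) - gradF (xt (t - 1))))\<^sup>2
      \<le> F (xt (t - 1)) - F (xt t) - gradF (xt t) \<bullet> (xt (t - 1) - xt t)"
    using assms unfolding smooth_ineq_on_def by blast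
  have "(norm (gradF (xt t) - gradF (xt (t - 1))))\<^sup>2 = 0"
    if "2 * (F (xt (t - 1)) - F (xt t) - gradF (xt t) \<bullet> (xt (t - 1) - xt t)) = 0"
  proof -
    have "1 / (2 * L) * (norm (gradF (xt t) - gradF (xt (t - 1))))\<^sup>2 \<le> 0"
      using le that by (metis mult_eq_0_iff zero_neq_numeral)
    then show ?thesis
      using \<open>L > 0\<close> by (auto simp: divide_le_0_iff)
  qed
  then have "ereal ((norm (gradF (xt t) - gradF (xt (t - 1))))\<^sup>2 /
      (2 * (F (xt (t - 1)) - F (xt t) - gradF (xt t) \<bullet> (xt (t - 1) - xt t)))) =
     ereal ((norm (gradF (xt t) - gradF (xt (t - 1))))\<^sup>2) /
     ereal (2 * (F (xt (t - 1)) - F (xt t) - gradF (xt t) \<bullet> (xt (t - 1) - xt t)))"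
    by (rule ereal_divide_if_zero)
  then show ?thesis
    using \<open>t \<ge> 2\<close> by (simp add: LF_est_def)
qed

definition L_tilde ::
    "real \<Rightarrow> real \<Rightarrow> real \<Rightarrow> (nat \<Rightarrow> real) \<Rightarrow> (nat \<Rightarrow> real) \<Rightarrow> nat \<Rightarrow> real" where
  "L_tilde \<beta> \<eta>\<^sub>1 \<mu> LK LF t =
     Max (insert (1 / (4 * (1 - \<beta>) * \<eta>\<^sub>1)) ((\<lambda>s. (LK s)\<^sup>2 / \<mu> + LF s) ` {1..t}))"

definition ergodic_avg :: "(nat \<Rightarrow> real) \<Rightarrow> (nat \<Rightarrow> 'a::real_vector) \<Rightarrow> nat \<Rightarrow> 'a" where
  "ergodic_avg \<eta> z k = (1 / (\<Sum>t=1..k. \<eta> (t + 1))) *\<^sub>R (\<Sum>t=1..k. \<eta> (t + 1) *\<^sub>R z t)"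

definition y_tilde ::
    "real \<Rightarrow> (nat \<Rightarrow> real) \<Rightarrow> (nat \<Rightarrow> real) \<Rightarrow> (nat \<Rightarrow> 'a::real_vector) \<Rightarrow> nat \<Rightarrow> 'a" where
  "y_tilde \<mu> \<eta> \<tau> y k =
     (1 / (\<mu> * (\<Sum>t=1..k. \<eta> (t + 1)))) *\<^sub>R
       ((\<Sum>t=1..k - 1. (\<eta> (t + 1) * (\<mu> + \<tau> t) - \<eta> (t + 2) * \<tau> (t + 1)) *\<^sub>R y t)
        + (\<eta> (k + 1) * (\<mu> + \<tau> k)) *\<^sub>R y k)"

end

theory Submission
  imports Defs
begin

text \<open>
  The proof is an energy argument whose error terms are measured along the trajectory, so that
  the local curvature \<open>M\<^sub>t = L\<^sub>K\<^sub>,\<^sub>t\<^sup>2 / \<mu> + L\<^sub>F\<^sub>,\<^sub>t\<close> takes the place of global Lipschitz constants.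

  The operator \<open>g\<^sub>t = K\<^sup>T y\<^sub>t + \<nabla>F(xt\<^sub>t)\<close> drives the step to \<open>x\<^sub>t\<^sub>+\<^sub>1\<close>. Testing the optimality of
  \<open>x\<^sub>t\<^sub>+\<^sub>1\<close> with \<open>x\<^sup>*\<close> and the optimality of \<open>x\<^sub>t\<close> with \<open>x\<^sub>t\<^sub>+\<^sub>1\<close> gives an inequality
  (\<open>step_inequality\<close>) for \<open>\<eta>\<^sub>t\<^sub>+\<^sub>1 (g\<^sub>t \<bullet> (x\<^sub>t - x\<^sup>*))\<close> in which the operator enters with the lag
  \<open>g\<^sub>t - g\<^sub>t\<^sub>-\<^sub>1\<close>. The lag is paid by two quantities that appear when \<open>g\<^sub>t \<bullet> (x\<^sub>t - x\<^sup>*)\<close> is bounded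
  below by a primal gap (\<open>gap_le_linearization\<close>): a Bregman distance of \<open>F\<close>, because \<open>x\<^sub>t\<close> is an
  extrapolation of \<open>xt\<^sub>t\<close> and \<open>xt\<^sub>t\<^sub>-\<^sub>1\<close>, and \<open>\<parallel>y\<^sub>t - y\<^sub>t\<^sub>-\<^sub>1\<parallel>\<^sup>2\<close>, because the residual
  \<open>K x\<^sub>t - B w\<^sub>t + b\<close> is the same extrapolation of \<open>y\<^sub>t\<close> and \<open>y\<^sub>t\<^sub>-\<^sub>1\<close>. The curvature rule for the
  step size is what leaves only \<open>\<parallel>x\<^sub>t\<^sub>+\<^sub>1 - x\<^sub>t\<parallel>\<^sup>2 / 8\<close> uncovered (\<open>operator_change_absorbed\<close>), and
  the quadratic terms of \<open>step_inequality\<close> dominate this remainder up to a telescoping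
  \<open>\<parallel>x\<^sub>t\<^sub>+\<^sub>1 - xbar\<^sub>t\<parallel>\<^sup>2 / 4\<close> (\<open>extrapolation_form_lower_bound\<close>). At \<open>t = 1\<close> no such help exists since
  \<open>\<tau>\<^sub>1 = 0\<close>; there monotonicity of the \<open>w\<close>-step bounds the lag by \<open>M\<^sub>1 \<parallel>x\<^sub>1 - x\<^sub>0\<parallel>\<close>
  (\<open>initial_operator_change\<close>), which is the origin of the second term of the constant.

  Summation by parts turns the summed gaps into combinations of \<open>F(xt\<^sub>t)\<close>, \<open>G(w\<^sub>t)\<close> and
  \<open>\<parallel>y\<^sub>t\<parallel>\<^sup>2\<close> with weights that are nonnegative by the second entry of the step-size minimum, and Jensen's
  inequality passes to the averages. This yields the primal gap plus \<open>\<mu> \<parallel>yt\<^sub>k\<parallel>\<^sup>2 / 2\<close> on the left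
  (\<open>ergodic_gap_le\<close>). The residual of the averages is exactly \<open>\<mu> yt\<^sub>k\<close>, and the saddle point
  inequality \<open>gap \<ge> - \<mu> (yt\<^sub>k \<bullet> y\<^sup>*)\<close> leaves a quadratic inequality for \<open>\<parallel>yt\<^sub>k\<parallel>\<close>.

  For the rate, \<open>\<tau>\<^sub>t\<close> grows at least like \<open>\<alpha> t / 2\<close> and at most like \<open>t / 2\<close> in units of \<open>\<mu>\<close>
  (\<open>growth\<close>), and an induction over the three entries of the minimum defining \<open>\<eta>\<^sub>t\<close> shows that
  \<open>\<eta>\<^sub>t\<close> grows at least linearly relative to the reciprocal of the largest curvature seen so far, with
  \<open>1 / (4 (1 - \<beta>) \<eta>\<^sub>1)\<close> as a curvature at the start (\<open>eta_lower_bound_truncated\<close>).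
\<close>

section \<open>First-order conditions and elementary inequalities\<close>

text \<open>
  Moving from the minimizer \<open>p\<close> a fraction \<open>\<theta>\<close> of the way to \<open>v\<close> changes the convex part by at most
  \<open>\<theta> (G v - G p)\<close> and the smooth part by \<open>\<theta> l + O(\<theta>\<^sup>2)\<close>. Dividing by \<open>\<theta>\<close> and letting \<open>\<theta>\<close> tend
  to 0 gives the variational inequality.
\<close>

lemma composite_minimizer_first_order:
  fixes G q :: "'a::real_vector \<Rightarrow> real"
  assumes min: "is_arg_min (\<lambda>v. G v + q v) (\<lambda>v. v \<in> W) p"
    and W: "convex W" and G: "convex_on W G" and v: "v \<in> W"
    and q: "\<And>\<theta>. 0 < \<theta> \<Longrightarrow> \<theta> \<le> 1 \<Longrightarrow> q (p + \<theta> *\<^sub>R (v - p)) - q p \<le> \<theta> * l + \<theta>\<^sup>2 * m"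
  shows "0 \<le> G v - G p + l"
proof -
  have p: "p \<in> W" and le: "\<And>u. u \<in> W \<Longrightarrow> G p + q p \<le> G u + q u"
    using min by (auto simp: is_arg_min_def not_less)
  have "0 \<le> G v - G p + l + \<theta> * m" if \<theta>: "0 < \<theta>" "\<theta> \<le> 1" for \<theta>
  proof -
    define u where "u = p + \<theta> *\<^sub>R (v - p)"
    have u: "u = (1 - \<theta>) *\<^sub>R p + \<theta> *\<^sub>R v" by (simp add: u_def algebra_simps)
    have "u \<in> W" unfolding u using W p v \<theta> by (simp add: convexD)
    moreover have "G u \<le> (1 - \<theta>) * G p + \<theta> * G v"
      unfolding u using G p v \<theta> by (intro convex_onD) auto
    ultimately have "G p + q p \<le> (1 - \<theta>) * G p + \<theta> * G v + (q p + \<theta> * l + \<theta>\<^sup>2 * m)"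
      using le[of u] q[OF \<theta>] unfolding u_def by linarith
    then have "0 \<le> \<theta> * (G v - G p + l + \<theta> * m)"
      by (simp add: algebra_simps power2_eq_square)
    then show ?thesis using \<theta> by (simp add: zero_le_mult_iff)
  qed
  then have "\<forall>\<^sub>F \<theta> in at_right 0. 0 \<le> G v - G p + l + \<theta> * m"
    unfolding eventually_at_right_field by (intro exI[of _ 1]) auto
  moreover have "((\<lambda>\<theta>. G v - G p + l + \<theta> * m) \<longlongrightarrow> G v - G p + l + 0 * m) (at_right 0)"
    by (intro tendsto_intros)
  ultimately have "0 \<le> G v - G p + l + 0 * m"
    by (intro tendsto_lowerbound[of _ _ "at_right (0::real)"]) auto
  then show ?thesis by simp
qed

lemma prox_step_first_order:
  fixes g z p u :: "'a::real_inner"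
  assumes "is_arg_min (\<lambda>u. \<eta> * (g \<bullet> u) + 1 / 2 * (norm (z - u))\<^sup>2) (\<lambda>u. u \<in> X) p"
    and "convex X" "u \<in> X"
  shows "\<eta> * (g \<bullet> (p - u)) \<le> (p - z) \<bullet> (u - p)"
proof -
  have "0 \<le> (0::real) - 0 + (\<eta> * (g \<bullet> (u - p)) + (p - z) \<bullet> (u - p))"
  proof (rule composite_minimizer_first_order[where G = "\<lambda>_. 0" and W = X and p = p and v = u
        and m = "1/2 * (norm (u - p))\<^sup>2"])
    show "is_arg_min (\<lambda>v. 0 + (\<eta> * (g \<bullet> v) + 1 / 2 * (norm (z - v))\<^sup>2)) (\<lambda>v. v \<in> X) p"
      using assms(1) by simp
    show "convex_on X (\<lambda>_. 0)" using assms(2) by (simp add: convex_on_const)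
    fix \<theta> :: real
    have "z - (p + \<theta> *\<^sub>R (u - p)) = (z - p) - \<theta> *\<^sub>R (u - p)" by simp
    then have "(norm (z - (p + \<theta> *\<^sub>R (u - p))))\<^sup>2
        = (norm (z - p))\<^sup>2 - 2 * \<theta> * ((z - p) \<bullet> (u - p)) + \<theta>\<^sup>2 * (norm (u - p))\<^sup>2"
      by (simp only: power2_norm_eq_inner inner_diff_left[of "z - p" "\<theta> *\<^sub>R (u - p)"]
          inner_diff_right[of _ "z - p" "\<theta> *\<^sub>R (u - p)"])
        (simp add: inner_commute power2_eq_square)
    moreover have "(z - p) \<bullet> (u - p) = - ((p - z) \<bullet> (u - p))"
      by (simp add: inner_diff_left)
    ultimately show "\<eta> * (g \<bullet> (p + \<theta> *\<^sub>R (u - p))) + 1 / 2 * (norm (z - (p + \<theta> *\<^sub>R (u - p))))\<^sup>2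
        - (\<eta> * (g \<bullet> p) + 1 / 2 * (norm (z - p))\<^sup>2)
      \<le> \<theta> * (\<eta> * (g \<bullet> (u - p)) + (p - z) \<bullet> (u - p)) + \<theta>\<^sup>2 * (1 / 2 * (norm (u - p))\<^sup>2)"
      by (simp add: inner_add_right algebra_simps)
  qed (use assms in auto)
  then show ?thesis by (simp add: inner_diff_right algebra_simps)
qed

text \<open>
  The three-point identity at \<open>q\<close> produces \<open>\<parallel>q - z\<parallel>\<^sup>2\<close>, which does not telescope in the method.
  Expressing it through the average \<open>(1 - \<beta>) p + \<beta> q\<close> produces a telescoping pair and, for \<open>\<beta> < 1\<close>, a
  larger multiple of \<open>\<parallel>q - p\<parallel>\<^sup>2\<close>.
\<close>

lemma averaging_identity:
  fixes p q z :: "'a::real_inner"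
  assumes "\<beta> \<noteq> 0"
  shows "(q - p) \<bullet> (z - q) = 1 / (2 * \<beta>) * ((norm (p - z))\<^sup>2
      - (norm ((1 - \<beta>) *\<^sub>R p + \<beta> *\<^sub>R q - z))\<^sup>2) - (2 - \<beta>) / 2 * (norm (q - p))\<^sup>2"
proof -
  have "(norm ((1 - \<beta>) *\<^sub>R p + \<beta> *\<^sub>R q - z))\<^sup>2 = (norm ((p - z) + \<beta> *\<^sub>R (q - p)))\<^sup>2"
    by (simp add: algebra_simps)
  also have "\<dots> = (norm (p - z))\<^sup>2 + 2 * \<beta> * ((p - z) \<bullet> (q - p)) + \<beta>\<^sup>2 * (norm (q - p))\<^sup>2"
    by (simp only: power2_norm_eq_inner inner_add_left inner_add_right inner_scaleR_left
        inner_scaleR_right) (simp add: inner_commute power2_eq_square algebra_simps)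
  finally have *: "(norm ((1 - \<beta>) *\<^sub>R p + \<beta> *\<^sub>R q - z))\<^sup>2 = \<dots>" .
  have "z - q = - ((p - z) + (q - p))" by simp
  then have "(q - p) \<bullet> (z - q) = - ((p - z) \<bullet> (q - p)) - (norm (q - p))\<^sup>2"
    by (simp only: inner_minus_right inner_add_right power2_norm_eq_inner) (simp add: inner_commute)
  then show ?thesis unfolding * using assms by (simp add: field_simps power2_eq_square)
qed

text \<open>
  Young's inequality for a norm \<open>n\<close> that is controlled only through a local estimate
  \<open>n\<^sup>2 \<le> 2 L D\<close>: the weight \<open>\<rho>\<close> says how much of \<open>D\<close> may be spent.
\<close>

lemma young_product:
  fixes n d \<rho> L D :: real
  assumes "n\<^sup>2 \<le> 2 * L * D" "0 \<le> L" "0 \<le> D" "0 < \<rho>"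
  shows "n * d \<le> \<rho> * D + L / (2 * \<rho>) * d\<^sup>2"
proof (rule power2_le_imp_le)
  define P Q where "P = \<rho> * D" and "Q = L / (2 * \<rho>) * d\<^sup>2"
  have "(n * d)\<^sup>2 \<le> 2 * L * D * d\<^sup>2"
    using assms(1) by (simp add: power_mult_distrib mult_right_mono)
  also have "\<dots> = 4 * P * Q" using assms(4) by (simp add: P_def Q_def field_simps)
  also have "\<dots> \<le> (P + Q)\<^sup>2"
    using zero_le_power2[of "P - Q"] by (simp add: power2_eq_square algebra_simps)
  finally show "(n * d)\<^sup>2 \<le> (\<rho> * D + L / (2 * \<rho>) * d\<^sup>2)\<^sup>2" unfolding P_def Q_def .
qed (use assms in auto)

text \<open>
  Here \<open>u\<close> is the current prox displacement, \<open>v\<close> is \<open>s\<close> times the previous one and \<open>a\<close> is the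
  squared norm of the previous one. After \<open>s\<close> is replaced by the bounds \<open>s \<ge> 4 / 5\<close> and \<open>s \<le> 1\<close>,
  the difference of both sides is affine in \<open>c\<close>, so that it suffices to see that the quadratic form
  in \<open>u, v\<close> is nonnegative at \<open>c = 0\<close> and at \<open>c = 2\<close>. The potential \<open>1 / 4\<close> is the one with which
  the first step of the method can also be closed.
\<close>

lemma extrapolation_form_lower_bound:
  fixes u v :: "'a::real_inner"
  assumes s: "4 / 5 \<le> s" "s \<le> 1" and c: "0 \<le> c" "c \<le> 2"
    and v: "(norm v)\<^sup>2 = s\<^sup>2 * a"
  shows "1 / 4 * (norm u)\<^sup>2 - 1 / 4 * a
    \<le> (1 + s) / 2 * (norm u)\<^sup>2 - c * (v \<bullet> (u - v)) - 1 / 8 * (norm (u - v))\<^sup>2"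
proof -
  define U V I where "U = (norm u)\<^sup>2" and "V = (norm v)\<^sup>2" and "I = u \<bullet> v"
  have UV: "0 \<le> U" "0 \<le> V" by (auto simp: U_def V_def)
  have a: "V \<le> a"
  proof -
    have "0 < s\<^sup>2" using s by simp
    then have "0 \<le> a" using v zero_le_power2[of "norm v"] by (simp add: zero_le_mult_iff)
    moreover have "s\<^sup>2 \<le> 1" using s by (simp add: power_le_one)
    ultimately show ?thesis unfolding V_def v by (simp add: mult_left_le_one_le)
  qed
  \<comment> \<open>these two squares bound the mixed term at the endpoints \<open>c = 0\<close> and \<open>c = 2\<close>\<close>
  have n0: "0 \<le> (norm (2 *\<^sub>R u + v))\<^sup>2" by simp
  have n1: "0 \<le> (norm (u - 2 *\<^sub>R v))\<^sup>2" by simp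
  have e0: "- (4 * U + V) \<le> 4 * I"
    using n0 by (simp add: U_def V_def I_def power2_norm_eq_inner inner_simps inner_commute)
  have e1: "4 * I \<le> U + 4 * V"
    using n1 by (simp add: U_def V_def I_def power2_norm_eq_inner inner_simps inner_commute)
  have nuv: "(norm (u - v))\<^sup>2 = U + V - 2 * I" "v \<bullet> (u - v) = I - V"
    by (simp_all add: U_def V_def I_def power2_norm_eq_inner inner_simps inner_commute)
  have c0: "0 \<le> (2 - c) * (21 / 40 * U + 1 / 8 * V + 1 / 4 * I)"
    using e0 c UV by (intro mult_nonneg_nonneg) auto
  have c2: "0 \<le> c * (21 / 40 * U + 17 / 8 * V - 7 / 4 * I)"
    using e1 c UV by (intro mult_nonneg_nonneg) auto
  have "2 * (21 / 40 * U + (c + 1 / 8) * V - (c - 1 / 4) * I)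
      = (2 - c) * (21 / 40 * U + 1 / 8 * V + 1 / 4 * I)
        + c * (21 / 40 * U + 17 / 8 * V - 7 / 4 * I)"
    by (simp add: field_simps)
  moreover have "0 \<le> r" if "0 \<le> i" "0 \<le> j" "2 * r = i + j" for i j r :: real
    using that by linarith
  ultimately have "0 \<le> 21 / 40 * U + (c + 1 / 8) * V - (c - 1 / 4) * I"
    using c0 c2 by blast
  then have "c * I \<le> 21 / 40 * U + c * V + 1 / 8 * V + 1 / 4 * I" by (simp add: algebra_simps)
  moreover have "9 / 10 * U \<le> (1 + s) / 2 * U" using s UV by (intro mult_right_mono) auto
  moreover have "1 / 4 * U - 1 / 4 * a \<le> sU - (cI - cV) - 1 / 8 * (U + V - 2 * I)"
    if "cI \<le> 21 / 40 * U + cV + 1 / 8 * V + 1 / 4 * I" "9 / 10 * U \<le> sU" for cI cV sU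
    using that a by (simp add: field_simps)
  ultimately show ?thesis unfolding nuv U_def[symmetric] right_diff_distrib[of c] by blast
qed

lemma inner_transpose_mult: "(transpose A *v a) \<bullet> u = a \<bullet> (A *v u)" for A :: "real^'n^'m"
  by (simp add: dot_lmul_matrix)

text \<open>
  The update of \<open>y\<close> is chosen so that the smooth part of the \<open>w\<close>-objective has gradient \<open>- B\<^sup>T y\<close>
  at the minimizer, where \<open>y\<close> is the new multiplier.
\<close>

lemma w_step_first_order:
  fixes B :: "real^'p^'m" and y' c :: "real^'m"
  assumes min: "is_arg_min (\<lambda>v. G v + 1 / (\<tau> + \<mu>) *
        (- \<tau> * (y' \<bullet> (B *v v)) + 1 / 2 * (norm (B *v v - c))\<^sup>2)) (\<lambda>v. v \<in> W) p"
    and W: "convex W" and G: "convex_on W G" and v: "v \<in> W"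
    and y: "y = (1 / (\<tau> + \<mu>)) *\<^sub>R (\<tau> *\<^sub>R y' - (B *v p - c))"
  shows "G p \<le> G v + y \<bullet> (B *v p - B *v v)"
proof -
  define s where "s = 1 / (\<tau> + \<mu>)"
  define h where "h = B *v v - B *v p"
  have "0 \<le> G v - G p + s * (- \<tau> * (y' \<bullet> h) + (B *v p - c) \<bullet> h)"
  proof (rule composite_minimizer_first_order[OF min W G v, where m = "s * (1 / 2 * (norm h)\<^sup>2)"])
    fix \<theta> :: real
    have B: "B *v (p + \<theta> *\<^sub>R (v - p)) = B *v p + \<theta> *\<^sub>R h"
      by (simp add: h_def matrix_vector_right_distrib matrix_vector_mult_diff_distrib
          matrix_vector_mult_scaleR)
    have "B *v p + \<theta> *\<^sub>R h - c = (B *v p - c) + \<theta> *\<^sub>R h" by simp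
    then have n: "(norm (B *v p + \<theta> *\<^sub>R h - c))\<^sup>2
        = (norm (B *v p - c))\<^sup>2 + 2 * \<theta> * ((B *v p - c) \<bullet> h) + \<theta>\<^sup>2 * (norm h)\<^sup>2"
      by (simp only: power2_norm_eq_inner inner_add_left[of "B *v p - c" "\<theta> *\<^sub>R h"]
          inner_add_right[of _ "B *v p - c" "\<theta> *\<^sub>R h"])
        (simp add: inner_commute power2_eq_square)
    show "1 / (\<tau> + \<mu>) * (- \<tau> * (y' \<bullet> (B *v (p + \<theta> *\<^sub>R (v - p))))
          + 1 / 2 * (norm (B *v (p + \<theta> *\<^sub>R (v - p)) - c))\<^sup>2)
        - 1 / (\<tau> + \<mu>) * (- \<tau> * (y' \<bullet> (B *v p)) + 1 / 2 * (norm (B *v p - c))\<^sup>2)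
        \<le> \<theta> * (s * (- \<tau> * (y' \<bullet> h) + (B *v p - c) \<bullet> h)) + \<theta>\<^sup>2 * (s * (1 / 2 * (norm h)\<^sup>2))"
      unfolding B n s_def[symmetric] by (simp add: inner_add_right algebra_simps)
  qed
  moreover have "s * (- \<tau> * (y' \<bullet> h) + (B *v p - c) \<bullet> h) = - (y \<bullet> h)"
    unfolding y s_def[symmetric] by (simp add: inner_diff_left algebra_simps)
  ultimately show ?thesis by (simp add: h_def inner_diff_right)
qed

section \<open>Feasibility of the iterates\<close>

lemma iterates_in_domains:
  assumes "aadmm_iteration X W gradF G K B b \<mu> bt \<eta> \<tau> tt x xbar xt w y"
  shows "x t \<in> X" "w t \<in> W"
proof -
  show "x t \<in> X"
    using assms unfolding aadmm_iteration_def is_arg_min_def by (cases "t = 0") auto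
  show "w t \<in> W"
    using assms unfolding aadmm_iteration_def is_arg_min_def by (cases "t = 0") auto
qed

lemma averaged_iterates_in_domain:
  assumes iter: "aadmm_iteration X W gradF G K B b \<mu> bt \<eta> \<tau> tt x xbar xt w y"
    and X: "convex X" and tt: "\<And>s. 1 \<le> s \<Longrightarrow> s \<le> t \<Longrightarrow> 0 \<le> tt s"
  shows "xt t \<in> X"
  using tt
proof (induction t)
  case 0
  then show ?case using iter by (auto simp: aadmm_iteration_def)
next
  case (Suc t)
  have xt: "xt (Suc t) = (1 / (1 + tt (Suc t))) *\<^sub>R (x (Suc t) + tt (Suc t) *\<^sub>R xt t)"
    using iter unfolding aadmm_iteration_def by (elim conjE) (drule spec[of _ "Suc t"], simp)
  have "0 \<le> tt (Suc t)" using Suc.prems by simp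
  then have t: "0 \<le> tt (Suc t)" "0 < 1 + tt (Suc t)" by auto
  have "(1 / (1 + tt (Suc t))) *\<^sub>R x (Suc t) + (tt (Suc t) / (1 + tt (Suc t))) *\<^sub>R xt t \<in> X"
    using X iterates_in_domains(1)[OF iter] Suc t
    by (intro convexD) (simp_all add: add_divide_distrib[symmetric])
  then show ?case unfolding xt by (simp add: scaleR_add_right)
qed

lemma LF_est_nonneg:
  assumes "smooth_ineq_on X F gradF L" "0 < L" "xt t \<in> X" "xt (t - 1) \<in> X"
  shows "0 \<le> LF_est F gradF xt t"
proof -
  have "1 / (2 * L) * (norm (gradF (xt t) - gradF (xt (t - 1))))\<^sup>2
      \<le> F (xt (t - 1)) - F (xt t) - gradF (xt t) \<bullet> (xt (t - 1) - xt t)"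
    using assms unfolding smooth_ineq_on_def by blast
  moreover have "0 \<le> 1 / (2 * L) * (norm (gradF (xt t) - gradF (xt (t - 1))))\<^sup>2"
    using assms(2) by simp
  ultimately have "0 \<le> F (xt (t - 1)) - F (xt t) - gradF (xt t) \<bullet> (xt (t - 1) - xt t)"
    by linarith
  then show ?thesis unfolding LF_est_def by (auto intro!: divide_nonneg_nonneg)
qed

section \<open>Weights of extrapolated sums\<close>

text \<open>
  The coefficient that \<open>f t\<close> collects in the sum of the extrapolations
  \<open>\<eta> (t + 1) * ((\<mu> + \<tau> t) * f t - \<tau> t * f (t - 1))\<close> for \<open>t = 1, \<dots>, k\<close>.
\<close>

definition extrapolation_weight ::
    "real \<Rightarrow> (nat \<Rightarrow> real) \<Rightarrow> (nat \<Rightarrow> real) \<Rightarrow> nat \<Rightarrow> nat \<Rightarrow> real" where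
  "extrapolation_weight \<mu> \<eta> \<tau> k t =
     \<eta> (t + 1) * (\<mu> + \<tau> t) - (if t = k then 0 else \<eta> (t + 2) * \<tau> (t + 1))"

text \<open>
  Singling out the last weight matches the form in which \<open>y_tilde\<close> is defined.
\<close>

lemma sum_extrapolation_weight_split:
  fixes f :: "nat \<Rightarrow> 'a::real_vector"
  assumes "1 \<le> k"
  shows "(\<Sum>t=1..k. extrapolation_weight \<mu> \<eta> \<tau> k t *\<^sub>R f t)
    = (\<Sum>t=1..k - 1. (\<eta> (t + 1) * (\<mu> + \<tau> t) - \<eta> (t + 2) * \<tau> (t + 1)) *\<^sub>R f t)
      + (\<eta> (k + 1) * (\<mu> + \<tau> k)) *\<^sub>R f k"
proof -
  obtain j where "k = Suc j" using assms by (cases k) auto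
  then show ?thesis by (auto simp: extrapolation_weight_def intro!: sum.cong)
qed

text \<open>
  Summation by parts; the boundary term at \<open>f 0\<close> vanishes because \<open>\<tau> 1 = 0\<close>.
\<close>

lemma sum_extrapolation:
  fixes f :: "nat \<Rightarrow> 'a::real_vector"
  assumes "\<tau> 1 = (0::real)" "1 \<le> k"
  shows "(\<Sum>t=1..k. \<eta> (t + 1) *\<^sub>R ((\<mu> + \<tau> t) *\<^sub>R f t - \<tau> t *\<^sub>R f (t - 1)))
    = (\<Sum>t=1..k. extrapolation_weight \<mu> \<eta> \<tau> k t *\<^sub>R f t)"
  unfolding sum_extrapolation_weight_split[OF assms(2)]
  using assms(2)
proof (induction k rule: dec_induct)
  case base
  then show ?case using assms(1) by simp
next
  case (step k)
  obtain j where j: "k = Suc j" using step(1) by (cases k) auto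
  show ?case using step.IH unfolding j by (simp add: algebra_simps)
qed

section \<open>Energy descent of the iteration\<close>

text \<open>
  The descent argument uses only inequalities between the parameters, so these are the assumptions
  here; the explicit step-size rule is shown to satisfy them later. The bound \<open>\<beta> \<le> 1 / 5\<close> is
  implied by \<open>\<beta> \<le> 1 - sqrt 6 / 3\<close>.
\<close>

locale ac_aadmm =
  fixes X :: "(real^'n) set" and W :: "(real^'p) set"
    and K :: "real^'n^'m" and B :: "real^'p^'m" and b :: "real^'m"
    and F :: "real^'n \<Rightarrow> real" and gradF :: "real^'n \<Rightarrow> real^'n" and G :: "real^'p \<Rightarrow> real"
    and L :: real
    and xs :: "real^'n" and ws :: "real^'p" and ys :: "real^'m"
    and \<mu> \<beta> :: real and bt \<eta> \<tau> tt :: "nat \<Rightarrow> real"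
    and x xbar xt :: "nat \<Rightarrow> real^'n" and w :: "nat \<Rightarrow> real^'p" and y :: "nat \<Rightarrow> real^'m"
  assumes X: "convex X" and W: "convex W" and G: "convex_on W G" and F: "convex_on X F"
    and L: "0 < L" and smooth: "smooth_ineq_on X F gradF L"
    and saddle: "saddle_point X W F G K B b xs ws ys"
    and feasible: "B *v ws - K *v xs = b"
    and iter: "aadmm_iteration X W gradF G K B b \<mu> bt \<eta> \<tau> tt x xbar xt w y"
    and mu: "0 < \<mu>"
    and beta: "0 < \<beta>" "\<beta> \<le> 1 / 5"
    and bt: "bt 1 = 0" "\<And>t. 2 \<le> t \<Longrightarrow> bt t = \<beta>"
    and eta_pos: "\<And>t. 1 \<le> t \<Longrightarrow> 0 < \<eta> t"
    and tau_1: "\<tau> 1 = 0" and tau_pos: "\<And>t. 2 \<le> t \<Longrightarrow> 0 < \<tau> t"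
    and tt: "\<And>t. 1 \<le> t \<Longrightarrow> tt t = \<tau> t / \<mu>"
    and eta_2: "\<eta> 2 \<le> (1 - \<beta>) * \<eta> 1"
      "\<eta> 2 * (4 * ((LK_est K y 1)\<^sup>2 / \<mu> + LF_est F gradF xt 1)) \<le> 1"
    and eta_growth: "\<And>t. 2 \<le> t \<Longrightarrow> \<eta> (t + 1) \<le> 4 / 3 * \<eta> t"
    and eta_tau: "\<And>t. 2 \<le> t \<Longrightarrow> \<eta> (t + 1) * \<tau> t \<le> (\<tau> (t - 1) + \<mu>) * \<eta> t"
    and eta_curvature: "\<And>t. 2 \<le> t \<Longrightarrow>
      \<eta> (t + 1) * (4 * (\<mu> * LF_est F gradF xt t + (LK_est K y t)\<^sup>2)) \<le> \<tau> t"
begin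

abbreviation "LK \<equiv> LK_est K y"
abbreviation "LF \<equiv> LF_est F gradF xt"

definition "g t = transpose K *v y t + gradF (xt t)"

text \<open>
  The Bregman distance of \<open>F\<close> between consecutive averaged iterates.
\<close>

definition "breg t = F (xt (t - 1)) - F (xt t) - gradF (xt t) \<bullet> (xt (t - 1) - xt t)"

text \<open>
  The optimality condition of \<open>x t\<close> is multiplied by \<open>\<eta> (t + 1) / \<eta> t\<close> to match that of
  \<open>x (t + 1)\<close>; passing from \<open>xbar (t - 1)\<close> to \<open>xbar t\<close> in it contributes the other factor.
\<close>

definition "step_ratio t = \<eta> (t + 1) / (\<eta> t * (1 - bt t))"

lemma tau_nonneg: "1 \<le> t \<Longrightarrow> 0 \<le> \<tau> t"
  using tau_1 tau_pos[of t] by (cases "t = 1") auto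

lemma x_in: "x t \<in> X" and w_in: "w t \<in> W" and xt_in: "xt t \<in> X"
  using iterates_in_domains[OF iter] averaged_iterates_in_domain[OF iter X, of t] tt tau_nonneg mu
  by auto

lemma xs_in: "xs \<in> X" and ws_in: "ws \<in> W"
  using saddle by (auto simp: saddle_point_def)

lemma initial: "xbar 0 = x 0" "xt 0 = x 0" "xbar 1 = x 0" "xt 1 = x 1"
  using iter bt(1) tt[of 1] tau_1 by (auto simp: aadmm_iteration_def)

lemma x_step:
  assumes "z \<in> X"
  shows "\<eta> (t + 1) * (g t \<bullet> (x (t + 1) - z)) \<le> (x (t + 1) - xbar t) \<bullet> (z - x (t + 1))"
proof (rule prox_step_first_order[OF _ X assms])
  show "is_arg_min (\<lambda>u. \<eta> (t + 1) * (g t \<bullet> u) + 1 / 2 * (norm (xbar t - u))\<^sup>2)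
      (\<lambda>u. u \<in> X) (x (t + 1))"
    using iter unfolding aadmm_iteration_def g_def
    by (elim conjE) (drule spec[of _ "t + 1"], simp)
qed

lemma xbar_step: "xbar (t + 1) = (1 - bt (t + 1)) *\<^sub>R xbar t + bt (t + 1) *\<^sub>R x (t + 1)"
  using iter unfolding aadmm_iteration_def by (elim conjE) (drule spec[of _ "t + 1"], simp)

lemma x_minus_xbar:
  assumes "1 \<le> t"
  shows "x t - xbar t = (1 - bt t) *\<^sub>R (x t - xbar (t - 1))"
  using xbar_step[of "t - 1"] assms by (simp add: algebra_simps)

lemma x_eq_extrapolation:
  assumes "1 \<le> t"
  shows "\<mu> *\<^sub>R x t = (\<mu> + \<tau> t) *\<^sub>R xt t - \<tau> t *\<^sub>R xt (t - 1)"
proof -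
  have "xt t = (1 / (1 + tt t)) *\<^sub>R (x t + tt t *\<^sub>R xt (t - 1))"
    using iter assms unfolding aadmm_iteration_def by blast
  moreover have "1 + tt t \<noteq> 0"
    using tt[OF assms] tau_nonneg[OF assms] mu divide_nonneg_pos[of "\<tau> t" \<mu>] by linarith
  ultimately have "(1 + tt t) *\<^sub>R xt t = x t + tt t *\<^sub>R xt (t - 1)" by simp
  then have "\<mu> *\<^sub>R x t = \<mu> *\<^sub>R ((1 + tt t) *\<^sub>R xt t - tt t *\<^sub>R xt (t - 1))" by simp
  then show ?thesis using mu tt[OF assms] by (simp add: algebra_simps)
qed

lemma residual_eq_extrapolation:
  assumes "1 \<le> t"
  shows "K *v x t - B *v w t + b = (\<mu> + \<tau> t) *\<^sub>R y t - \<tau> t *\<^sub>R y (t - 1)"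
proof -
  have "y t = (1 / (\<tau> t + \<mu>)) *\<^sub>R (\<tau> t *\<^sub>R y (t - 1) - (B *v w t - K *v x t - b))"
    using iter assms unfolding aadmm_iteration_def by blast
  moreover have "\<tau> t + \<mu> \<noteq> 0" using mu tau_nonneg[OF assms] by simp
  ultimately have "(\<tau> t + \<mu>) *\<^sub>R y t = \<tau> t *\<^sub>R y (t - 1) - (B *v w t - K *v x t - b)" by simp
  then show ?thesis by (simp add: algebra_simps)
qed

text \<open>
  The initial pair \<open>(w 0, y 0)\<close> has the form of a \<open>w\<close>-step with \<open>\<tau> = 0\<close> and previous multiplier 0.
\<close>

lemma w_step:
  assumes "v \<in> W"
  shows "G (w t) \<le> G v + y t \<bullet> (B *v w t - B *v v)"
proof (cases "t = 0")
  case True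
  have "is_arg_min (\<lambda>v. G v + 1 / (0 + \<mu>) *
      (- 0 * (0 \<bullet> (B *v v)) + 1 / 2 * (norm (B *v v - (K *v x 0 + b)))\<^sup>2)) (\<lambda>v. v \<in> W) (w 0)"
    using iter by (auto simp: aadmm_iteration_def diff_diff_eq mult.commute[of \<mu>])
  moreover have "y 0 = (1 / (0 + \<mu>)) *\<^sub>R (0 *\<^sub>R 0 - (B *v w 0 - (K *v x 0 + b)))"
    using iter by (simp add: aadmm_iteration_def algebra_simps)
  ultimately show ?thesis unfolding True by (rule w_step_first_order[OF _ W G assms])
next
  case False
  have "is_arg_min (\<lambda>v. G v + 1 / (\<tau> t + \<mu>) *
      (- \<tau> t * (y (t - 1) \<bullet> (B *v v)) + 1 / 2 * (norm (B *v v - (K *v x t + b)))\<^sup>2)) (\<lambda>v. v \<in> W) (w t)"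
    using iter False by (auto simp: aadmm_iteration_def diff_diff_eq)
  moreover have "y t = (1 / (\<tau> t + \<mu>)) *\<^sub>R (\<tau> t *\<^sub>R y (t - 1) - (B *v w t - (K *v x t + b)))"
    using iter False by (simp add: aadmm_iteration_def diff_diff_eq)
  ultimately show ?thesis by (rule w_step_first_order[OF _ W G assms])
qed

lemma step_ratio_bounds:
  assumes "1 \<le> t"
  shows "0 \<le> step_ratio t" "t = 1 \<Longrightarrow> step_ratio t = \<eta> 2 / \<eta> 1" "t = 1 \<Longrightarrow> step_ratio t \<le> 1 - \<beta>"
    "2 \<le> t \<Longrightarrow> step_ratio t \<le> 2"
proof -
  have b: "bt t < 1" using bt beta assms by (cases "t = 1") auto
  show "0 \<le> step_ratio t" using eta_pos[OF assms] eta_pos[of "t + 1"] b by (simp add: step_ratio_def)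
  show "t = 1 \<Longrightarrow> step_ratio t = \<eta> 2 / \<eta> 1" using bt(1) by (simp add: step_ratio_def numeral_2_eq_2)
  moreover have "\<eta> 2 / \<eta> 1 \<le> 1 - \<beta>" using eta_2(1) eta_pos[of 1] by (simp add: pos_divide_le_eq)
  ultimately show "t = 1 \<Longrightarrow> step_ratio t \<le> 1 - \<beta>" by simp
  show "step_ratio t \<le> 2" if t: "2 \<le> t"
  proof -
    have "4 / 3 * \<eta> t \<le> 2 * (\<eta> t * (1 - \<beta>))"
      using eta_pos[OF assms] mult_left_mono[of "4 / 5" "1 - \<beta>" "\<eta> t"] beta by linarith
    then have "\<eta> (t + 1) \<le> 2 * (\<eta> t * (1 - bt t))"
      using eta_growth[OF t] bt(2)[OF t] by simp
    moreover have "0 < \<eta> t * (1 - bt t)" using eta_pos[OF assms] b by simp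
    ultimately show ?thesis by (simp add: step_ratio_def pos_divide_le_eq)
  qed
qed

text \<open>
  The optimality of \<open>x (t + 1)\<close> is tested with \<open>z\<close>, that of \<open>x t\<close> with \<open>x (t + 1)\<close>. The second one
  contains \<open>g (t - 1)\<close>, so the sum pairs \<open>g t\<close> with \<open>x t - z\<close> instead of \<open>x (t + 1) - z\<close>, at the
  price of the lag \<open>g t - g (t - 1)\<close>. The point \<open>x t\<close> is the one whose position relative to \<open>xt t\<close>
  and \<open>y t\<close>, the arguments of \<open>g t\<close>, is known.
\<close>

lemma step_inequality:
  assumes t: "1 \<le> t" and z: "z \<in> X"
  shows "\<eta> (t + 1) * (g t \<bullet> (x t - z)) + \<eta> (t + 1) * ((g t - g (t - 1)) \<bullet> (x (t + 1) - x t))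
    + (2 - \<beta>) / 2 * (norm (x (t + 1) - xbar t))\<^sup>2
    - step_ratio t * ((x t - xbar t) \<bullet> (x (t + 1) - x t))
    + 1 / (2 * \<beta>) * ((norm (xbar (t + 1) - z))\<^sup>2 - (norm (xbar t - z))\<^sup>2) \<le> 0"
proof -
  have b: "bt t < 1" using bt beta t by (cases "t = 1") auto
  have eta: "0 < \<eta> t" "0 < \<eta> (t + 1)" using eta_pos t by auto
  have e1: "\<eta> t * (g (t - 1) \<bullet> (x t - x (t + 1))) \<le> (x t - xbar (t - 1)) \<bullet> (x (t + 1) - x t)"
    using x_step[OF x_in[of "t + 1"], of "t - 1"] t by simp
  have "\<eta> (t + 1) * (g (t - 1) \<bullet> (x t - x (t + 1)))
      = \<eta> (t + 1) / \<eta> t * (\<eta> t * (g (t - 1) \<bullet> (x t - x (t + 1))))"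
    using eta by simp
  also have "\<dots> \<le> \<eta> (t + 1) / \<eta> t * ((x t - xbar (t - 1)) \<bullet> (x (t + 1) - x t))"
    using e1 eta by (intro mult_left_mono) auto
  also have "\<dots> = step_ratio t * ((x t - xbar t) \<bullet> (x (t + 1) - x t))"
    using b eta by (simp add: step_ratio_def x_minus_xbar[OF t])
  finally have e1: "\<eta> (t + 1) * (g (t - 1) \<bullet> (x t - x (t + 1)))
      \<le> step_ratio t * ((x t - xbar t) \<bullet> (x (t + 1) - x t))" .
  have e2: "\<eta> (t + 1) * (g t \<bullet> (x (t + 1) - z)) \<le> (x (t + 1) - xbar t) \<bullet> (z - x (t + 1))"
    by (rule x_step[OF z])
  have e3: "(x (t + 1) - xbar t) \<bullet> (z - x (t + 1))
      = 1 / (2 * \<beta>) * ((norm (xbar t - z))\<^sup>2 - (norm (xbar (t + 1) - z))\<^sup>2)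
        - (2 - \<beta>) / 2 * (norm (x (t + 1) - xbar t))\<^sup>2"
    unfolding xbar_step[of t] using averaging_identity[of \<beta> "x (t + 1)" "xbar t" z]
      beta bt(2)[of "t + 1"] t
    by simp
  have "g t \<bullet> (x t - z) + (g t - g (t - 1)) \<bullet> (x (t + 1) - x t)
      = g t \<bullet> (x (t + 1) - z) + g (t - 1) \<bullet> (x t - x (t + 1))"
    by (simp add: inner_diff_left inner_diff_right)
  then have "\<eta> (t + 1) * (g t \<bullet> (x t - z)) + \<eta> (t + 1) * ((g t - g (t - 1)) \<bullet> (x (t + 1) - x t))
      = \<eta> (t + 1) * (g t \<bullet> (x (t + 1) - z)) + \<eta> (t + 1) * (g (t - 1) \<bullet> (x t - x (t + 1)))"
    by (metis distrib_left)
  moreover have "1 / (2 * \<beta>) * ((norm (xbar (t + 1) - z))\<^sup>2 - (norm (xbar t - z))\<^sup>2)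
      = - (1 / (2 * \<beta>) * ((norm (xbar t - z))\<^sup>2 - (norm (xbar (t + 1) - z))\<^sup>2))"
    by (simp add: algebra_simps)
  ultimately show ?thesis using e1 e2 e3 by linarith
qed

text \<open>
  The contribution of step \<open>t\<close> to the primal gap, in extrapolated form: the terms in \<open>F\<close> and in
  \<open>\<parallel>y\<parallel>\<^sup>2\<close> are differences that become nonnegative combinations only after weighting with
  \<open>\<eta> (t + 1)\<close> and summation over \<open>t\<close>.
\<close>

definition "gap t = (\<mu> + \<tau> t) / \<mu> * F (xt t) - \<tau> t / \<mu> * F (xt (t - 1)) - F xs + G (w t) - G ws
  + 1 / 2 * ((\<mu> + \<tau> t) * (norm (y t))\<^sup>2 - \<tau> t * (norm (y (t - 1)))\<^sup>2)"

lemma breg_nonneg: "0 \<le> breg t"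
  and gradient_difference: "(norm (gradF (xt t) - gradF (xt (t - 1))))\<^sup>2 \<le> 2 * L * breg t"
proof -
  have "1 / (2 * L) * (norm (gradF (xt t) - gradF (xt (t - 1))))\<^sup>2 \<le> breg t"
    using smooth xt_in unfolding smooth_ineq_on_def breg_def by blast
  then show *: "(norm (gradF (xt t) - gradF (xt (t - 1))))\<^sup>2 \<le> 2 * L * breg t"
    using L by (simp add: field_simps)
  then have "0 \<le> 2 * L * breg t" by (rule order_trans[OF zero_le_power2])
  then show "0 \<le> breg t" using L by (simp add: zero_le_mult_iff)
qed

text \<open>
  The case of a vanishing Bregman distance, in which the estimate has the form \<open>0 / 0\<close>, is covered by
  the global bound: it forces the gradient difference to vanish.
\<close>

lemma gradient_difference_local:
  assumes "2 \<le> t"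
  shows "(norm (gradF (xt t) - gradF (xt (t - 1))))\<^sup>2 = 2 * LF t * breg t"
  using gradient_difference[of t] assms unfolding LF_est_def breg_def[symmetric]
  by (cases "breg t = 0") auto

lemma LF_nonneg: "0 \<le> LF t"
  using LF_est_nonneg[OF smooth L xt_in xt_in] .

lemma LK_est_eq: "norm (transpose K *v (y t - y (t - 1))) = LK t * norm (y t - y (t - 1))"
  unfolding LK_est_def by (cases "y t = y (t - 1)") auto

text \<open>
  Since \<open>x t\<close> equals \<open>xt t\<close> plus \<open>\<tau> t / \<mu>\<close> times the last increment of \<open>xt\<close>, the definition of the
  Bregman distance evaluates the gradient along this increment exactly. Since the residual
  at step \<open>t\<close> equals \<open>\<mu> y\<^sub>t + \<tau>\<^sub>t (y\<^sub>t - y\<^sub>t\<^sub>-\<^sub>1)\<close>, polarization evaluates its inner product with \<open>y\<^sub>t\<close>.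
\<close>

lemma gap_le_linearization:
  assumes t: "1 \<le> t"
  shows "gap t + \<tau> t / \<mu> * breg t + \<tau> t / 2 * (norm (y t - y (t - 1)))\<^sup>2 \<le> g t \<bullet> (x t - xs)"
proof -
  have xs_le: "F (xt t) - F xs \<le> gradF (xt t) \<bullet> (xt t - xs)"
  proof -
    have "0 \<le> 1 / (2 * L) * (norm (gradF (xt t) - gradF xs))\<^sup>2" using L by simp
    also have "\<dots> \<le> F xs - F (xt t) - gradF (xt t) \<bullet> (xs - xt t)"
      using smooth xt_in xs_in unfolding smooth_ineq_on_def by blast
    finally show ?thesis by (simp add: inner_diff_right)
  qed
  have "\<mu> *\<^sub>R (x t - xs) = \<mu> *\<^sub>R (xt t - xs) + \<tau> t *\<^sub>R (xt t - xt (t - 1))"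
    using x_eq_extrapolation[OF t] by (simp add: algebra_simps)
  then have "(1 / \<mu>) *\<^sub>R (\<mu> *\<^sub>R (x t - xs)) = (1 / \<mu>) *\<^sub>R (\<mu> *\<^sub>R (xt t - xs) + \<tau> t *\<^sub>R (xt t - xt (t - 1)))"
    by (simp only:)
  then have "x t - xs = (xt t - xs) + (\<tau> t / \<mu>) *\<^sub>R (xt t - xt (t - 1))"
    using mu by (simp add: scaleR_add_right)
  then have F_part: "gradF (xt t) \<bullet> (x t - xs)
      = gradF (xt t) \<bullet> (xt t - xs) + \<tau> t / \<mu> * (F (xt t) - F (xt (t - 1)) + breg t)"
    by (simp add: inner_add_right breg_def inner_diff_right)
  have "(transpose K *v y t) \<bullet> (x t - xs) = y t \<bullet> (K *v x t - K *v xs)"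
    unfolding inner_transpose_mult by (simp add: matrix_vector_mult_diff_distrib)
  also have "K *v x t - K *v xs = (K *v x t - B *v w t + b) + (B *v w t - B *v ws)"
    using feasible by (auto simp: algebra_simps)
  also have "y t \<bullet> \<dots> = y t \<bullet> ((\<mu> + \<tau> t) *\<^sub>R y t - \<tau> t *\<^sub>R y (t - 1)) + y t \<bullet> (B *v w t - B *v ws)"
    unfolding residual_eq_extrapolation[OF t] by (rule inner_add_right)
  also have "y t \<bullet> ((\<mu> + \<tau> t) *\<^sub>R y t - \<tau> t *\<^sub>R y (t - 1))
      = \<mu> / 2 * (norm (y t))\<^sup>2 + 1 / 2 * ((\<mu> + \<tau> t) * (norm (y t))\<^sup>2 - \<tau> t * (norm (y (t - 1)))\<^sup>2)
        + \<tau> t / 2 * (norm (y t - y (t - 1)))\<^sup>2"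
    by (simp add: power2_norm_eq_inner inner_diff_left inner_diff_right inner_add_right
        inner_commute field_simps)
  finally have y_part: "(transpose K *v y t) \<bullet> (x t - xs) = \<dots> + y t \<bullet> (B *v w t - B *v ws)" .
  have "G (w t) - G ws \<le> y t \<bullet> (B *v w t - B *v ws)" using w_step[OF ws_in, of t] by linarith
  moreover have "0 \<le> \<mu> / 2 * (norm (y t))\<^sup>2" using mu by simp
  moreover have "(\<mu> + \<tau> t) / \<mu> * F (xt t) = F (xt t) + \<tau> t / \<mu> * F (xt t)"
    using mu by (simp add: field_simps)
  ultimately show ?thesis
    using xs_le F_part y_part unfolding g_def gap_def inner_add_left by (simp add: algebra_simps)
qed

text \<open>
  The gradient part of the lag is charged to the Bregman distance and the part in \<open>K\<close> to the change
  of \<open>y\<close>. What both charges leave is \<open>(\<mu> L\<^sub>F + L\<^sub>K\<^sup>2) / (2 \<tau>)\<close> times \<open>\<parallel>dx\<parallel>\<^sup>2\<close>, and the curvature rule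
  bounds \<open>\<eta> (t + 1)\<close> times this coefficient by \<open>1 / 8\<close>.
\<close>

lemma operator_change_absorbed:
  assumes t: "2 \<le> t"
  shows "- (1 / 8 * (norm dx)\<^sup>2) \<le> \<eta> (t + 1) * ((g t - g (t - 1)) \<bullet> dx)
    + \<eta> (t + 1) * (\<tau> t / \<mu> * breg t + \<tau> t / 2 * (norm (y t - y (t - 1)))\<^sup>2)"
proof -
  define dy df where "dy = y t - y (t - 1)" and "df = gradF (xt t) - gradF (xt (t - 1))"
  have tau: "0 < \<tau> t" using tau_pos[OF t] .
  have eta: "0 < \<eta> (t + 1)" using eta_pos by simp
  have "transpose K *v y t - transpose K *v y (t - 1) = transpose K *v dy"
    unfolding dy_def by (rule matrix_vector_mult_diff_distrib[symmetric])
  then have g: "g t - g (t - 1) = transpose K *v dy + df"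
    unfolding g_def df_def by (simp add: algebra_simps)
  have "- ((transpose K *v dy) \<bullet> dx) \<le> norm (transpose K *v dy) * norm dx"
    using Cauchy_Schwarz_ineq2[of "transpose K *v dy" dx] by linarith
  also have "\<dots> = LK t * norm dy * norm dx" using LK_est_eq[of t] by (simp add: dy_def)
  also have "\<dots> \<le> \<tau> t * (1 / 2 * (norm dy)\<^sup>2) + (LK t)\<^sup>2 / (2 * \<tau> t) * (norm dx)\<^sup>2"
    using tau by (intro young_product) (auto simp: power_mult_distrib)
  finally have K: "- ((transpose K *v dy) \<bullet> dx) \<le> \<dots>" .
  have "- (df \<bullet> dx) \<le> norm df * norm dx"
    using Cauchy_Schwarz_ineq2[of df dx] by linarith
  also have "\<dots> \<le> \<tau> t / \<mu> * breg t + LF t / (2 * (\<tau> t / \<mu>)) * (norm dx)\<^sup>2"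
    using gradient_difference_local[OF t] LF_nonneg breg_nonneg tau mu
    by (intro young_product) (auto simp: df_def)
  finally have F: "- (df \<bullet> dx) \<le> \<dots>" .
  define C where "C = (LK t)\<^sup>2 / (2 * \<tau> t) + LF t / (2 * (\<tau> t / \<mu>))"
  have C: "\<eta> (t + 1) * C \<le> 1 / 8"
  proof -
    have "\<eta> (t + 1) * C = \<eta> (t + 1) * (4 * (\<mu> * LF t + (LK t)\<^sup>2)) / (8 * \<tau> t)"
      using tau mu by (simp add: C_def field_simps)
    also have "\<dots> \<le> \<tau> t / (8 * \<tau> t)"
      using eta_curvature[OF t] tau by (intro divide_right_mono) auto
    finally show ?thesis using tau by simp
  qed
  have "- ((g t - g (t - 1)) \<bullet> dx)
      \<le> (\<tau> t / \<mu> * breg t + \<tau> t / 2 * (norm dy)\<^sup>2) + C * (norm dx)\<^sup>2"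
    using K F unfolding g inner_add_left C_def by (simp add: distrib_right)
  then have "\<eta> (t + 1) * (- ((g t - g (t - 1)) \<bullet> dx))
      \<le> \<eta> (t + 1) * ((\<tau> t / \<mu> * breg t + \<tau> t / 2 * (norm dy)\<^sup>2) + C * (norm dx)\<^sup>2)"
    using eta by (intro mult_left_mono) auto
  moreover have "\<eta> (t + 1) * C * (norm dx)\<^sup>2 \<le> 1 / 8 * (norm dx)\<^sup>2"
    using C by (intro mult_right_mono) auto
  ultimately show ?thesis unfolding dy_def by (simp add: distrib_left mult.assoc)
qed

lemma descent:
  assumes t: "2 \<le> t"
  shows "\<eta> (t + 1) * gap t + 1 / 4 * (norm (x (t + 1) - xbar t))\<^sup>2
      + 1 / (2 * \<beta>) * (norm (xbar (t + 1) - xs))\<^sup>2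
    \<le> 1 / 4 * (norm (x t - xbar (t - 1)))\<^sup>2 + 1 / (2 * \<beta>) * (norm (xbar t - xs))\<^sup>2"
proof -
  define u v where "u = x (t + 1) - xbar t" and "v = x t - xbar t"
  define Q \<kappa> where "Q = (2 - \<beta>) / 2 * (norm u)\<^sup>2" and "\<kappa> = 1 / (2 * \<beta>)"
  have uv: "x (t + 1) - x t = u - v" by (simp add: u_def v_def)
  have "\<eta> (t + 1) * (gap t + \<tau> t / \<mu> * breg t + \<tau> t / 2 * (norm (y t - y (t - 1)))\<^sup>2)
      \<le> \<eta> (t + 1) * (g t \<bullet> (x t - xs))"
    using gap_le_linearization[of t] eta_pos[of "t + 1"] t by (intro mult_left_mono) auto
  then have "\<eta> (t + 1) * gap t
      + \<eta> (t + 1) * (\<tau> t / \<mu> * breg t + \<tau> t / 2 * (norm (y t - y (t - 1)))\<^sup>2)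
      \<le> \<eta> (t + 1) * (g t \<bullet> (x t - xs))"
    by (simp add: distrib_left)
  moreover note operator_change_absorbed[OF t, of "u - v"]
  moreover have "\<eta> (t + 1) * (g t \<bullet> (x t - xs)) + \<eta> (t + 1) * ((g t - g (t - 1)) \<bullet> (u - v))
    + Q - step_ratio t * (v \<bullet> (u - v))
    + (\<kappa> * (norm (xbar (t + 1) - xs))\<^sup>2 - \<kappa> * (norm (xbar t - xs))\<^sup>2) \<le> 0"
    using step_inequality[OF _ xs_in, of t] t unfolding uv right_diff_distrib[of "1 / (2 * \<beta>)"]
    by (simp add: u_def v_def Q_def \<kappa>_def)
  moreover have "1 / 4 * (norm u)\<^sup>2 - 1 / 4 * (norm (x t - xbar (t - 1)))\<^sup>2
      \<le> (1 + (1 - \<beta>)) / 2 * (norm u)\<^sup>2 - step_ratio t * (v \<bullet> (u - v)) - 1 / 8 * (norm (u - v))\<^sup>2"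
    using beta step_ratio_bounds[of t] t x_minus_xbar[of t] bt(2)[OF t]
    by (intro extrapolation_form_lower_bound) (auto simp: v_def power_mult_distrib)
  moreover have "(1 + (1 - \<beta>)) / 2 * (norm u)\<^sup>2 = Q" by (simp add: Q_def)
  ultimately show ?thesis unfolding u_def[symmetric] \<kappa>_def[symmetric] by linarith
qed

text \<open>
  The optimality conditions of \<open>w 0\<close> and \<open>w 1\<close> say that the change of \<open>y\<close> and the change of \<open>B w\<close>
  have a nonnegative inner product, and the updates give
  \<open>B (w 1 - w 0) = K (x 1 - x 0) - \<mu> (y 1 - y 0)\<close>. Together they bound the change of \<open>y\<close> by
  \<open>L\<^sub>K / \<mu>\<close> times that of \<open>x\<close>.
\<close>

lemma initial_operator_change:
  "norm (g 1 - g 0) \<le> ((LK 1)\<^sup>2 / \<mu> + LF 1) * norm (x 1 - x 0)"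
proof -
  define dy dx where "dy = y 1 - y 0" and "dx = x 1 - x 0"
  have mono: "0 \<le> dy \<bullet> (B *v w 1 - B *v w 0)"
    using w_step[OF w_in, of 1 0] w_step[OF w_in, of 0 1]
    by (simp add: dy_def inner_diff_left inner_diff_right)
  have y1: "K *v x 1 - B *v w 1 + b = \<mu> *\<^sub>R y 1"
    using residual_eq_extrapolation[of 1] tau_1 by simp
  have y0: "K *v x 0 - B *v w 0 + b = \<mu> *\<^sub>R y 0"
    using iter mu by (simp add: aadmm_iteration_def)
  have "B *v w 1 - B *v w 0
      = (K *v x 1 - K *v x 0) - ((K *v x 1 - B *v w 1 + b) - (K *v x 0 - B *v w 0 + b))"
    by simp
  also have "\<dots> = K *v dx - \<mu> *\<^sub>R dy"
    unfolding y0 y1 by (simp add: dx_def dy_def algebra_simps)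
  finally have "\<mu> * (norm dy)\<^sup>2 \<le> dy \<bullet> (K *v dx)"
    using mono by (simp add: inner_diff_right power2_norm_eq_inner)
  also have "\<dots> \<le> norm (transpose K *v dy) * norm dx"
    unfolding inner_transpose_mult[symmetric] by (rule norm_cauchy_schwarz)
  also have KT: "norm (transpose K *v dy) = LK 1 * norm dy"
    using LK_est_eq[of 1] by (simp add: dy_def)
  finally have "norm dy * (\<mu> * norm dy) \<le> norm dy * (LK 1 * norm dx)"
    by (simp add: power2_eq_square mult_ac)
  then have "\<mu> * norm dy \<le> LK 1 * norm dx \<or> norm dy = 0"
    by (auto simp: mult_le_cancel_left)
  moreover have LK: "0 \<le> LK 1" by (simp add: LK_est_def)
  ultimately have "norm dy \<le> LK 1 * norm dx / \<mu>"
    using mu by (auto simp: field_simps)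
  then have "norm (transpose K *v dy) \<le> LK 1 * (LK 1 * norm dx / \<mu>)"
    unfolding KT using LK by (rule mult_left_mono)
  moreover have "norm (gradF (xt 1) - gradF (xt 0)) = LF 1 * norm dx"
    using initial by (cases "dx = 0") (auto simp: LF_est_def dx_def)
  moreover have "transpose K *v y 1 - transpose K *v y 0 = transpose K *v dy"
    unfolding dy_def by (rule matrix_vector_mult_diff_distrib[symmetric])
  then have "g 1 - g 0 = transpose K *v dy + (gradF (xt 1) - gradF (xt 0))"
    unfolding g_def by (simp add: algebra_simps)
  then have "norm (g 1 - g 0) \<le> norm (transpose K *v dy) + norm (gradF (xt 1) - gradF (xt 0))"
    by (metis norm_triangle_ineq)
  ultimately show ?thesis unfolding dx_def[symmetric] by (simp add: field_simps power2_eq_square)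
qed

text \<open>
  Without a Bregman term to spend, the lag \<open>M\<^sub>1 \<parallel>v\<parallel> (\<parallel>u\<parallel> + \<parallel>v\<parallel>)\<close>, where \<open>u = x 2 - x 0\<close> and
  \<open>v = x 1 - x 0\<close>, is split so that
  \<open>\<eta> 2 * M\<^sub>1 \<le> 1 / 4\<close> makes the part in \<open>u\<close> harmless; the part in \<open>v\<close> stays on the right with the
  factor \<open>1 + 1 / 4\<close>.
\<close>

lemma initial_descent:
  "\<eta> 2 * gap 1 + 1 / 4 * (norm (x 2 - xbar 1))\<^sup>2 + 1 / (2 * \<beta>) * (norm (xbar 2 - xs))\<^sup>2
    \<le> 1 / (2 * \<beta>) * (norm (x 0 - xs))\<^sup>2
      + \<eta> 2 * (5 / 4 * ((LK 1)\<^sup>2 / \<mu> + LF 1) - 1 / (4 * \<eta> 1)) * (norm (x 1 - x 0))\<^sup>2"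
proof -
  define u v M where "u = x 2 - x 0" and "v = x 1 - x 0" and "M = (LK 1)\<^sup>2 / \<mu> + LF 1"
  define P \<kappa> where "P = (1 - \<beta>) / 2 * (norm u)\<^sup>2" and "\<kappa> = 1 / (2 * \<beta>)"
  have eta: "0 < \<eta> 1" "0 < \<eta> 2" using eta_pos by auto
  have M: "0 \<le> M" using mu LF_nonneg by (simp add: M_def)
  have uv: "x 2 - x 1 = u - v" by (simp add: u_def v_def)
  have "gap 1 \<le> g 1 \<bullet> (x 1 - xs)" using gap_le_linearization[of 1] tau_1 by simp
  then have e1: "\<eta> 2 * gap 1 \<le> \<eta> 2 * (g 1 \<bullet> (x 1 - xs))" using eta by simp
  have e2: "\<eta> 2 * (g 1 \<bullet> (x 1 - xs)) + \<eta> 2 * ((g 1 - g 0) \<bullet> (u - v))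
    + (P + 1 / 2 * (norm u)\<^sup>2) - step_ratio 1 * (v \<bullet> (u - v))
    + (\<kappa> * (norm (xbar 2 - xs))\<^sup>2 - \<kappa> * (norm (x 0 - xs))\<^sup>2) \<le> 0"
  proof -
    have "(2 - \<beta>) / 2 * (norm u)\<^sup>2 = P + 1 / 2 * (norm u)\<^sup>2"
      by (simp add: P_def field_simps)
    moreover have "x (1 + 1) - xbar 1 = u" "x 1 - xbar 1 = v" "x (1 + 1) - x 1 = u - v"
        "xbar (1 + 1) = xbar 2" "\<eta> (1 + 1) = \<eta> 2" "g (1 - 1) = g 0"
      using initial by (simp_all add: u_def v_def numeral_2_eq_2)
    ultimately show ?thesis
      using step_inequality[of 1, OF order_refl xs_in] initial(3)
      unfolding \<kappa>_def[symmetric] right_diff_distrib[of \<kappa>] by (simp only:)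
  qed
  have "- ((g 1 - g 0) \<bullet> (u - v)) \<le> norm (g 1 - g 0) * norm (u - v)"
    using Cauchy_Schwarz_ineq2[of "g 1 - g 0" "u - v"] by linarith
  also have "\<dots> \<le> (M * norm v) * (norm u + norm v)"
    using initial_operator_change M by (intro mult_mono norm_triangle_ineq4) (auto simp: M_def v_def)
  also have "\<dots> \<le> M * (5 / 4 * (norm v)\<^sup>2 + (norm u)\<^sup>2)"
  proof -
    have "0 \<le> (norm u - 1 / 2 * norm v)\<^sup>2" by simp
    then have "norm v * (norm u + norm v) \<le> 5 / 4 * (norm v)\<^sup>2 + (norm u)\<^sup>2"
      by (simp add: power2_eq_square algebra_simps)
    then show ?thesis using M by (simp add: mult.assoc mult_left_mono)
  qed
  finally have "\<eta> 2 * (- ((g 1 - g 0) \<bullet> (u - v))) \<le> \<eta> 2 * (M * (5 / 4 * (norm v)\<^sup>2 + (norm u)\<^sup>2))"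
    using eta by (intro mult_left_mono) auto
  moreover have "\<eta> 2 * M * (norm u)\<^sup>2 \<le> 1 / 4 * (norm u)\<^sup>2"
  proof (rule mult_right_mono)
    have "4 * (\<eta> 2 * M) \<le> 1" using eta_2(2) by (simp only: M_def mult.left_commute)
    then show "\<eta> 2 * M \<le> 1 / 4" by simp
  qed simp
  ultimately have e3: "- (\<eta> 2 * ((g 1 - g 0) \<bullet> (u - v)))
      \<le> 5 / 4 * (\<eta> 2 * M * (norm v)\<^sup>2) + 1 / 4 * (norm u)\<^sup>2"
    by (simp add: algebra_simps)
  have "v \<bullet> (u - v) = 1 / 2 * ((norm u)\<^sup>2 - (norm v)\<^sup>2 - (norm (u - v))\<^sup>2)"
    by (simp add: power2_norm_eq_inner inner_diff_left inner_diff_right inner_commute)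
  also have "\<dots> \<le> 1 / 2 * ((norm u)\<^sup>2 - (norm v)\<^sup>2)" by simp
  finally have "step_ratio 1 * (v \<bullet> (u - v)) \<le> step_ratio 1 * (1 / 2 * ((norm u)\<^sup>2 - (norm v)\<^sup>2))"
    using step_ratio_bounds(1)[of 1] by (intro mult_left_mono) auto
  moreover have "step_ratio 1 * (norm u)\<^sup>2 \<le> (1 - \<beta>) * (norm u)\<^sup>2"
    using step_ratio_bounds(3)[of 1] by (intro mult_right_mono) auto
  moreover have "0 \<le> step_ratio 1 * (norm v)\<^sup>2" using step_ratio_bounds(1)[of 1] by simp
  ultimately have e4: "step_ratio 1 * (v \<bullet> (u - v)) \<le> P - 1 / 4 * (step_ratio 1 * (norm v)\<^sup>2)"
    by (simp add: P_def algebra_simps)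
  have e5: "\<eta> 2 * (5 / 4 * M - 1 / (4 * \<eta> 1)) * (norm v)\<^sup>2
      = 5 / 4 * (\<eta> 2 * M * (norm v)\<^sup>2) - 1 / 4 * (step_ratio 1 * (norm v)\<^sup>2)"
    using step_ratio_bounds(2)[of 1] eta by (simp add: field_simps)
  have xu: "x 2 - xbar 1 = u" using initial by (simp add: u_def)
  show ?thesis
    using e1 e2 e3 e4 unfolding xu M_def[symmetric] v_def[symmetric] e5 \<kappa>_def[symmetric] by linarith
qed

lemma sum_gap_le:
  assumes "1 \<le> k"
  shows "(\<Sum>t=1..k. \<eta> (t + 1) * gap t)
    \<le> 1 / (2 * \<beta>) * (norm (x 0 - xs))\<^sup>2
      + \<eta> 2 * (5 / 4 * ((LK 1)\<^sup>2 / \<mu> + LF 1) - 1 / (4 * \<eta> 1)) * (norm (x 1 - x 0))\<^sup>2"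
    (is "_ \<le> ?D")
proof -
  have "(\<Sum>t=1..k. \<eta> (t + 1) * gap t) + 1 / 4 * (norm (x (k + 1) - xbar k))\<^sup>2
      + 1 / (2 * \<beta>) * (norm (xbar (k + 1) - xs))\<^sup>2 \<le> ?D"
    using assms
  proof (induction k rule: dec_induct)
    case base
    then show ?case using initial_descent by (simp add: numeral_2_eq_2)
  next
    case (step k)
    then show ?case using descent[of "Suc k"] by simp
  qed
  moreover have "0 \<le> 1 / (2 * \<beta>) * (norm (xbar (k + 1) - xs))\<^sup>2" using beta by simp
  moreover have "0 \<le> 1 / 4 * (norm (x (k + 1) - xbar k))\<^sup>2" by simp
  ultimately show ?thesis by linarith
qed

section \<open>Ergodic bounds\<close>

definition "total_stepsize k = (\<Sum>t=1..k. \<eta> (t + 1))"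

abbreviation "wgt \<equiv> extrapolation_weight \<mu> \<eta> \<tau>"

lemma total_stepsize_pos:
  assumes "1 \<le> k"
  shows "0 < total_stepsize k"
  unfolding total_stepsize_def using assms eta_pos by (intro sum_pos) auto

lemma ergodic_avg_eq: "ergodic_avg \<eta> z k = (\<Sum>t=1..k. (\<eta> (t + 1) / total_stepsize k) *\<^sub>R z t)"
  unfolding ergodic_avg_def total_stepsize_def[symmetric] by (simp add: scaleR_sum_right)

lemma ergodic_weights: "1 \<le> k \<Longrightarrow> (\<Sum>t=1..k. \<eta> (t + 1) / total_stepsize k) = 1"
  using total_stepsize_pos[of k] unfolding sum_divide_distrib[symmetric] total_stepsize_def[symmetric] by simp

lemma scaled_ergodic_avg:
  "1 \<le> k \<Longrightarrow> total_stepsize k *\<^sub>R ergodic_avg \<eta> z k = (\<Sum>t=1..k. \<eta> (t + 1) *\<^sub>R z t)"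
  using total_stepsize_pos[of k] unfolding ergodic_avg_def total_stepsize_def[symmetric] by simp

lemma wgt_nonneg:
  assumes "1 \<le> t"
  shows "0 \<le> wgt k t"
proof -
  have "\<eta> (t + 2) * \<tau> (t + 1) \<le> \<eta> (t + 1) * (\<mu> + \<tau> t)"
    using eta_tau[of "t + 1"] assms by (simp add: algebra_simps)
  moreover have "0 \<le> \<eta> (t + 1) * (\<mu> + \<tau> t)"
    using eta_pos[of "t + 1"] tau_nonneg[OF assms] mu by simp
  ultimately show ?thesis by (auto simp: extrapolation_weight_def)
qed

text \<open>
  Extrapolation preserves constants up to the factor \<open>\<mu>\<close>.
\<close>

lemma sum_wgt:
  assumes "1 \<le> k"
  shows "(\<Sum>t=1..k. wgt k t) = \<mu> * total_stepsize k"
  using sum_extrapolation[where \<tau> = \<tau> and \<eta> = \<eta> and \<mu> = \<mu> and f = "\<lambda>_. 1 :: real", OF tau_1 assms]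
  by (simp add: total_stepsize_def sum_distrib_left mult.commute)

text \<open>
  The average of the \<open>x t\<close> with weights \<open>\<eta> (t + 1)\<close> is the average of the \<open>xt t\<close> with the
  extrapolation weights, and \<open>y_tilde\<close> is the average of the \<open>y t\<close> with the same weights. This is why
  values of \<open>F\<close> at the points \<open>xt t\<close> suffice to bound \<open>F\<close> at the ergodic average of \<open>x\<close>.
\<close>

lemma scaled_averages:
  assumes "1 \<le> k"
  shows "(\<mu> * total_stepsize k) *\<^sub>R ergodic_avg \<eta> x k = (\<Sum>t=1..k. wgt k t *\<^sub>R xt t)"
    and "(\<mu> * total_stepsize k) *\<^sub>R y_tilde \<mu> \<eta> \<tau> y k = (\<Sum>t=1..k. wgt k t *\<^sub>R y t)"
proof -
  note S = total_stepsize_pos[OF assms]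
  have "(\<mu> * total_stepsize k) *\<^sub>R ergodic_avg \<eta> x k = \<mu> *\<^sub>R (\<Sum>t=1..k. \<eta> (t + 1) *\<^sub>R x t)"
    unfolding scaleR_scaleR[symmetric] scaled_ergodic_avg[OF assms] ..
  also have "\<dots> = (\<Sum>t=1..k. \<eta> (t + 1) *\<^sub>R (\<mu> *\<^sub>R x t))"
    by (simp add: scaleR_sum_right mult.commute)
  also have "\<dots> = (\<Sum>t=1..k. \<eta> (t + 1) *\<^sub>R ((\<mu> + \<tau> t) *\<^sub>R xt t - \<tau> t *\<^sub>R xt (t - 1)))"
    by (intro sum.cong) (simp_all add: x_eq_extrapolation)
  also have "\<dots> = (\<Sum>t=1..k. wgt k t *\<^sub>R xt t)" by (rule sum_extrapolation[where \<tau> = \<tau>, OF tau_1 assms])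
  finally show "(\<mu> * total_stepsize k) *\<^sub>R ergodic_avg \<eta> x k = \<dots>" .
  show "(\<mu> * total_stepsize k) *\<^sub>R y_tilde \<mu> \<eta> \<tau> y k = (\<Sum>t=1..k. wgt k t *\<^sub>R y t)"
    using S mu unfolding sum_extrapolation_weight_split[OF assms] y_tilde_def
      total_stepsize_def[symmetric] by simp
qed

lemma residual_of_averages:
  assumes "1 \<le> k"
  shows "K *v ergodic_avg \<eta> x k - B *v ergodic_avg \<eta> w k + b = \<mu> *\<^sub>R y_tilde \<mu> \<eta> \<tau> y k"
proof -
  note S = total_stepsize_pos[OF assms]
  have lin: "total_stepsize k *\<^sub>R (A *v ergodic_avg \<eta> z k) = (\<Sum>t=1..k. \<eta> (t + 1) *\<^sub>R (A *v z t))"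
    for A :: "real^'q^'m" and z :: "nat \<Rightarrow> real^'q"
  proof -
    have "A *v (total_stepsize k *\<^sub>R ergodic_avg \<eta> z k) = A *v (\<Sum>t=1..k. \<eta> (t + 1) *\<^sub>R z t)"
      unfolding scaled_ergodic_avg[OF assms] ..
    then show ?thesis
      by (simp add: matrix_vector_mult_scaleR linear_sum[OF matrix_vector_mul_linear])
  qed
  have "total_stepsize k *\<^sub>R (K *v ergodic_avg \<eta> x k - B *v ergodic_avg \<eta> w k + b)
      = (\<Sum>t=1..k. \<eta> (t + 1) *\<^sub>R (K *v x t - B *v w t + b))"
    unfolding scaleR_add_right scaleR_diff_right lin
    by (simp add: sum.distrib sum_subtractf scaleR_add_right scaleR_diff_right total_stepsize_def scaleR_sum_left)
  also have "\<dots> = (\<Sum>t=1..k. \<eta> (t + 1) *\<^sub>R ((\<mu> + \<tau> t) *\<^sub>R y t - \<tau> t *\<^sub>R y (t - 1)))"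
    by (intro sum.cong) (simp_all add: residual_eq_extrapolation)
  also have "\<dots> = (\<mu> * total_stepsize k) *\<^sub>R y_tilde \<mu> \<eta> \<tau> y k"
    unfolding scaled_averages(2)[OF assms] by (rule sum_extrapolation[where \<tau> = \<tau>, OF tau_1 assms])
  also have "\<dots> = total_stepsize k *\<^sub>R (\<mu> *\<^sub>R y_tilde \<mu> \<eta> \<tau> y k)" by (simp add: mult.commute)
  finally show ?thesis using S by (metis less_irrefl scaleR_left_imp_eq)
qed

lemma jensen_wgt:
  assumes k: "1 \<le> k" and f: "convex_on C f" and z: "\<And>t. z t \<in> C"
    and a: "(\<mu> * total_stepsize k) *\<^sub>R a = (\<Sum>t=1..k. wgt k t *\<^sub>R z t)"
  shows "\<mu> * total_stepsize k * f a \<le> (\<Sum>t=1..k. wgt k t * f (z t))"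
proof -
  have P: "0 < \<mu> * total_stepsize k" using mu total_stepsize_pos[OF k] by simp
  have "a = (1 / (\<mu> * total_stepsize k)) *\<^sub>R ((\<mu> * total_stepsize k) *\<^sub>R a)" using mu total_stepsize_pos[OF k] by simp
  also have "\<dots> = (\<Sum>t=1..k. (wgt k t / (\<mu> * total_stepsize k)) *\<^sub>R z t)"
    unfolding a by (simp add: scaleR_sum_right)
  finally have "f a = f (\<Sum>t=1..k. (wgt k t / (\<mu> * total_stepsize k)) *\<^sub>R z t)" by simp
  also have "\<dots> \<le> (\<Sum>t=1..k. wgt k t / (\<mu> * total_stepsize k) * f (z t))"
    using k P z wgt_nonneg sum_wgt[OF k]
    by (intro convex_on_sum[OF _ _ f]) (auto simp: sum_divide_distrib[symmetric])
  also have "\<dots> = (\<Sum>t=1..k. wgt k t * f (z t)) / (\<mu> * total_stepsize k)"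
    by (simp add: sum_divide_distrib)
  finally show ?thesis using P by (simp add: field_simps)
qed

lemma ergodic_gap_le:
  assumes k: "1 \<le> k"
  shows "total_stepsize k * (F (ergodic_avg \<eta> x k) + G (ergodic_avg \<eta> w k) - F xs - G ws
      + \<mu> / 2 * (norm (y_tilde \<mu> \<eta> \<tau> y k))\<^sup>2) \<le> (\<Sum>t=1..k. \<eta> (t + 1) * gap t)"
proof -
  note S = total_stepsize_pos[OF k]
  have Fj: "\<mu> * total_stepsize k * F (ergodic_avg \<eta> x k) \<le> (\<Sum>t=1..k. wgt k t * F (xt t))"
    by (rule jensen_wgt[OF k F xt_in scaled_averages(1)[OF k]])
  have yj: "\<mu> * total_stepsize k * (norm (y_tilde \<mu> \<eta> \<tau> y k))\<^sup>2 \<le> (\<Sum>t=1..k. wgt k t * (norm (y t))\<^sup>2)"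
  proof (rule jensen_wgt[OF k _ UNIV_I scaled_averages(2)[OF k], where f = "\<lambda>z. (norm z)\<^sup>2"])
    show "convex_on UNIV (\<lambda>z :: real^'m. (norm z)\<^sup>2)"
    proof (intro convex_onI)
      fix t :: real and p q :: "real^'m"
      assume t: "0 < t" "t < 1"
      have "(norm ((1 - t) *\<^sub>R p + t *\<^sub>R q))\<^sup>2
          = (1 - t) * (norm p)\<^sup>2 + t * (norm q)\<^sup>2 - t * (1 - t) * (norm (p - q))\<^sup>2"
        by (simp add: power2_norm_eq_inner inner_add_left inner_add_right inner_diff_left
            inner_diff_right inner_commute algebra_simps)
      then show "(norm ((1 - t) *\<^sub>R p + t *\<^sub>R q))\<^sup>2 \<le> (1 - t) * (norm p)\<^sup>2 + t * (norm q)\<^sup>2"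
        using t by simp
    qed simp
  qed
  have Gj: "total_stepsize k * G (ergodic_avg \<eta> w k) \<le> (\<Sum>t=1..k. \<eta> (t + 1) * G (w t))"
  proof -
    have "G (ergodic_avg \<eta> w k) \<le> (\<Sum>t=1..k. \<eta> (t + 1) / total_stepsize k * G (w t))"
      unfolding ergodic_avg_eq using k S eta_pos w_in
      by (intro convex_on_sum[OF _ _ G ergodic_weights[OF k]]) (auto simp: less_imp_le)
    also have "\<dots> = (\<Sum>t=1..k. \<eta> (t + 1) * G (w t)) / total_stepsize k" by (simp add: sum_divide_distrib)
    finally show ?thesis using S by (simp add: field_simps)
  qed
  have Fs: "(\<Sum>t=1..k. \<eta> (t + 1) * ((\<mu> + \<tau> t) / \<mu> * F (xt t) - \<tau> t / \<mu> * F (xt (t - 1))))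
      = (\<Sum>t=1..k. wgt k t * F (xt t)) / \<mu>"
  proof -
    have "(\<Sum>t=1..k. \<eta> (t + 1) * ((\<mu> + \<tau> t) / \<mu> * F (xt t) - \<tau> t / \<mu> * F (xt (t - 1))))
        = (\<Sum>t=1..k. \<eta> (t + 1) *\<^sub>R ((\<mu> + \<tau> t) *\<^sub>R F (xt t) - \<tau> t *\<^sub>R F (xt (t - 1)))) / \<mu>"
      unfolding sum_divide_distrib using mu by (intro sum.cong refl) (simp add: field_simps)
    also have "\<dots> = (\<Sum>t=1..k. wgt k t * F (xt t)) / \<mu>"
      unfolding sum_extrapolation[where \<tau> = \<tau> and f = "\<lambda>t. F (xt t)", OF tau_1 k] by simp
    finally show ?thesis .
  qed
  have ysum: "(\<Sum>t=1..k. \<eta> (t + 1) * ((\<mu> + \<tau> t) * (norm (y t))\<^sup>2 - \<tau> t * (norm (y (t - 1)))\<^sup>2))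
      = (\<Sum>t=1..k. wgt k t * (norm (y t))\<^sup>2)"
    using sum_extrapolation[where \<tau> = \<tau> and f = "\<lambda>t. (norm (y t))\<^sup>2", OF tau_1 k] by simp
  have "(\<Sum>t=1..k. \<eta> (t + 1) * gap t)
    = (\<Sum>t=1..k. \<eta> (t + 1) * ((\<mu> + \<tau> t) / \<mu> * F (xt t) - \<tau> t / \<mu> * F (xt (t - 1)))
        - \<eta> (t + 1) * (F xs + G ws) + \<eta> (t + 1) * G (w t)
        + 1 / 2 * (\<eta> (t + 1) * ((\<mu> + \<tau> t) * (norm (y t))\<^sup>2 - \<tau> t * (norm (y (t - 1)))\<^sup>2)))"
    unfolding gap_def by (intro sum.cong refl) algebra
  also have "\<dots> = (\<Sum>t=1..k. wgt k t * F (xt t)) / \<mu> - total_stepsize k * (F xs + G ws)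
      + (\<Sum>t=1..k. \<eta> (t + 1) * G (w t)) + 1 / 2 * (\<Sum>t=1..k. wgt k t * (norm (y t))\<^sup>2)"
    unfolding sum.distrib sum_subtractf Fs sum_distrib_left[symmetric] ysum
    by (simp add: total_stepsize_def sum_distrib_right)
  finally have eq: "(\<Sum>t=1..k. \<eta> (t + 1) * gap t) = \<dots>" .
  have "total_stepsize k * F (ergodic_avg \<eta> x k) \<le> (\<Sum>t=1..k. wgt k t * F (xt t)) / \<mu>"
    using Fj mu by (simp add: pos_le_divide_eq mult_ac)
  moreover have "total_stepsize k * (\<mu> / 2 * (norm (y_tilde \<mu> \<eta> \<tau> y k))\<^sup>2)
      \<le> 1 / 2 * (\<Sum>t=1..k. wgt k t * (norm (y t))\<^sup>2)"
    using yj by (simp add: mult_ac)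
  ultimately show ?thesis
    using Gj unfolding eq by (simp add: distrib_left right_diff_distrib)
qed

text \<open>
  At the averages the Lagrangian with multiplier \<open>ys\<close> is at least its saddle value, so the primal gap
  is at least \<open>- \<mu> \<parallel>Y\<parallel> \<parallel>ys\<parallel>\<close> with \<open>Y = y_tilde\<close>. Inserted into \<open>ergodic_gap_le\<close>, this becomes a
  quadratic inequality for \<open>\<mu> \<parallel>Y\<parallel>\<close>, which is solved by completing the square.
\<close>

lemma ergodic_convergence:
  assumes k: "1 \<le> k"
    and E: "1 / (2 * \<beta>) * (norm (x 0 - xs))\<^sup>2
      + \<eta> 2 * (5 / 4 * ((LK 1)\<^sup>2 / \<mu> + LF 1) - 1 / (4 * \<eta> 1)) * (norm (x 1 - x 0))\<^sup>2
      \<le> total_stepsize k * E"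
    and "0 \<le> E"
  shows "F (ergodic_avg \<eta> x k) + G (ergodic_avg \<eta> w k) - F xs - G ws \<le> E"
    and "norm (K *v ergodic_avg \<eta> x k - B *v ergodic_avg \<eta> w k + b) = \<mu> * norm (y_tilde \<mu> \<eta> \<tau> y k)"
    and "\<mu> * norm (y_tilde \<mu> \<eta> \<tau> y k) \<le> 2 * \<mu> * norm ys + 2 * sqrt (\<mu> * E)"
proof -
  note S = total_stepsize_pos[OF k]
  define Y where "Y = y_tilde \<mu> \<eta> \<tau> y k"
  define gp where "gp = F (ergodic_avg \<eta> x k) + G (ergodic_avg \<eta> w k) - F xs - G ws"
  have "total_stepsize k * (gp + \<mu> / 2 * (norm Y)\<^sup>2) \<le> total_stepsize k * E"
    using ergodic_gap_le[OF k] sum_gap_le[OF k] E by (simp add: gp_def Y_def)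
  then have le: "gp + \<mu> / 2 * (norm Y)\<^sup>2 \<le> E" using S by simp
  moreover have "0 \<le> \<mu> / 2 * (norm Y)\<^sup>2" using mu by simp
  ultimately show "F (ergodic_avg \<eta> x k) + G (ergodic_avg \<eta> w k) - F xs - G ws \<le> E"
    unfolding gp_def[symmetric] by linarith
  show "norm (K *v ergodic_avg \<eta> x k - B *v ergodic_avg \<eta> w k + b) = \<mu> * norm (y_tilde \<mu> \<eta> \<tau> y k)"
    unfolding residual_of_averages[OF k] using mu by simp
  have xk: "ergodic_avg \<eta> x k \<in> X" and wk: "ergodic_avg \<eta> w k \<in> W"
    unfolding ergodic_avg_eq using S eta_pos x_in w_in
    by (intro convex_sum[OF _ X ergodic_weights[OF k]] convex_sum[OF _ W ergodic_weights[OF k]];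
        simp add: less_imp_le)+
  have "lagrangian F G K B b xs ws ys
      \<le> lagrangian F G K B b (ergodic_avg \<eta> x k) (ergodic_avg \<eta> w k) ys"
    using saddle xk wk unfolding saddle_point_def by blast
  moreover have "K *v xs - B *v ws + b = 0" using feasible by (auto simp: algebra_simps)
  ultimately have "0 \<le> gp + \<mu> * (Y \<bullet> ys)"
    unfolding lagrangian_def residual_of_averages[OF k] by (simp add: gp_def Y_def)
  moreover have "\<mu> * (Y \<bullet> ys) \<le> \<mu> * (norm Y * norm ys)"
    using mu norm_cauchy_schwarz[of Y ys] by (intro mult_left_mono) auto
  ultimately have "\<mu> / 2 * (norm Y)\<^sup>2 \<le> E + \<mu> * (norm Y * norm ys)" using le by linarith
  then have "2 * \<mu> * (\<mu> / 2 * (norm Y)\<^sup>2) \<le> 2 * \<mu> * (E + \<mu> * (norm Y * norm ys))"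
    using mu by (intro mult_left_mono) auto
  then have sq: "(\<mu> * norm Y - \<mu> * norm ys)\<^sup>2 \<le> (\<mu> * norm ys)\<^sup>2 + 2 * (\<mu> * E)"
    by (simp add: power2_eq_square algebra_simps)
  also have "\<dots> \<le> (\<mu> * norm ys + 2 * sqrt (\<mu> * E))\<^sup>2"
  proof -
    have general: "p\<^sup>2 + 2 * r\<^sup>2 \<le> (p + 2 * r)\<^sup>2" if "0 \<le> p" "0 \<le> r" for p r :: real
      using mult_nonneg_nonneg[OF that] by (simp add: power2_eq_square algebra_simps)
    have sqrt: "(sqrt (\<mu> * E))\<^sup>2 = \<mu> * E" "0 \<le> sqrt (\<mu> * E)" using mu assms(3) by auto
    have "(\<mu> * norm ys)\<^sup>2 + 2 * (sqrt (\<mu> * E))\<^sup>2 \<le> (\<mu> * norm ys + 2 * sqrt (\<mu> * E))\<^sup>2"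
      using mu sqrt(2) by (intro general) auto
    then show ?thesis unfolding sqrt(1) .
  qed
  finally have "\<mu> * norm Y - \<mu> * norm ys \<le> \<mu> * norm ys + 2 * sqrt (\<mu> * E)"
    by (rule power2_le_imp_le) (use mu assms(3) in simp)
  then show "\<mu> * norm (y_tilde \<mu> \<eta> \<tau> y k) \<le> 2 * \<mu> * norm ys + 2 * sqrt (\<mu> * E)"
    by (simp add: Y_def)
qed

end

section \<open>Growth of the adaptive step sizes\<close>

text \<open>
  In the case \<open>q = 0\<close> the last entry is \<open>\<infinity>\<close> and drops out of the minimum; multiplying by \<open>q\<close>
  instead of dividing states both cases uniformly.
\<close>

lemma ereal_min_division_cases:
  assumes e: "ereal e = min (ereal a) (min (ereal c) (ereal d / ereal q))"
    and d: "0 < d" and q: "0 \<le> q"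
  shows "e \<le> a" "e \<le> c" "e * q \<le> d" "e = a \<or> e = c \<or> e * q = d"
proof -
  have "e \<le> a \<and> e \<le> c \<and> e * q \<le> d \<and> (e = a \<or> e = c \<or> e * q = d)"
  proof (cases "q = 0")
    case True
    have "ereal d / ereal q = \<infinity>" using d unfolding True by (rule ereal_div_conventions(2))
    then have "ereal e = min (ereal a) (ereal c)" using e by simp
    then have "e = min a c" by (simp add: ereal_min[symmetric] del: ereal_min)
    then show ?thesis using True d by (simp add: min_def)
  next
    case False
    then have "0 < q" using q by simp
    have "ereal d / ereal q = ereal (d / q)" using False by (subst ereal_divide_if_zero) auto
    then have "e = min a (min c (d / q))" using e by (simp add: ereal_min[symmetric] del: ereal_min)
    then have "e \<le> a \<and> e \<le> c \<and> e \<le> d / q \<and> (e = a \<or> e = c \<or> e = d / q)"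
      by (simp add: min_def)
    then show ?thesis using \<open>0 < q\<close> by (auto simp: pos_le_divide_eq)
  qed
  then show "e \<le> a" "e \<le> c" "e * q \<le> d" "e = a \<or> e = c \<or> e * q = d" by auto
qed

text \<open>
  \<open>M\<close> stands for the local curvature. Its nonnegativity at \<open>t\<close> is assumed only when \<open>\<tau>\<close> has been
  nonnegative up to \<open>t\<close>: the averaged iterates, from which the curvature is computed, are known to
  lie in \<open>X\<close> only in this case. The resulting mutual dependence is resolved in the induction for
  \<open>growth\<close>.
\<close>

locale adaptive_stepsizes =
  fixes \<mu> \<alpha> \<beta> :: real and \<eta> \<tau> M :: "nat \<Rightarrow> real"
  assumes mu: "0 < \<mu>" and alpha: "0 < \<alpha>" "\<alpha> \<le> 1" and beta: "\<beta> < 1"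
    and M_nonneg: "\<And>t. 1 \<le> t \<Longrightarrow> (\<And>s. 1 \<le> s \<Longrightarrow> s \<le> t \<Longrightarrow> 0 \<le> \<tau> s) \<Longrightarrow> 0 \<le> M t"
    and eta_1: "0 < \<eta> 1" and tau_1: "\<tau> 1 = 0" and tau_2: "\<tau> 2 = \<mu>"
    and eta_2: "ereal (\<eta> 2) = min (ereal ((1 - \<beta>) * \<eta> 1)) (ereal 1 / ereal (4 * M 1))"
    and eta_rule: "\<And>t. 3 \<le> t \<Longrightarrow> ereal (\<eta> t) =
        min (ereal (4 / 3 * \<eta> (t - 1)))
          (min (ereal ((\<tau> (t - 2) + \<mu>) / \<tau> (t - 1) * \<eta> (t - 1)))
            (ereal (\<tau> (t - 1)) / ereal (4 * \<mu> * M (t - 1))))"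
    and tau_rule: "\<And>t. 3 \<le> t \<Longrightarrow> \<tau> t =
        \<tau> (t - 1) + \<mu> / 2 * (\<alpha> + (1 - \<alpha>) * \<eta> t * (4 * \<mu> * M (t - 1) / \<tau> (t - 1)))"
begin

lemma eta_2_facts:
  "\<eta> 2 \<le> (1 - \<beta>) * \<eta> 1" "\<eta> 2 * (4 * M 1) \<le> 1" "\<eta> 2 = (1 - \<beta>) * \<eta> 1 \<or> \<eta> 2 * (4 * M 1) = 1"
  "0 < \<eta> 2"
proof -
  have M: "0 \<le> M 1" using M_nonneg[of 1] tau_1 by (metis le_antisym order.refl)
  have e: "ereal (\<eta> 2) = min (ereal ((1 - \<beta>) * \<eta> 1))
      (min (ereal ((1 - \<beta>) * \<eta> 1)) (ereal 1 / ereal (4 * M 1)))"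
    unfolding eta_2 by (simp add: min.left_idem)
  note f = ereal_min_division_cases[OF e]
  show "\<eta> 2 \<le> (1 - \<beta>) * \<eta> 1" "\<eta> 2 * (4 * M 1) \<le> 1"
    "\<eta> 2 = (1 - \<beta>) * \<eta> 1 \<or> \<eta> 2 * (4 * M 1) = 1"
    using f M by auto
  then have "\<eta> 2 = (1 - \<beta>) * \<eta> 1 \<or> \<eta> 2 * (4 * M 1) = 1" by blast
  moreover have "0 < (1 - \<beta>) * \<eta> 1" using beta eta_1 by simp
  ultimately show "0 < \<eta> 2" using M by (smt (verit) mult_nonneg_nonneg mult_nonpos_nonneg)
qed

lemma eta_Suc:
  assumes "2 \<le> t"
  shows "ereal (\<eta> (Suc t)) = min (ereal (4 / 3 * \<eta> t))
      (min (ereal ((\<tau> (t - 1) + \<mu>) / \<tau> t * \<eta> t)) (ereal (\<tau> t) / ereal (4 * \<mu> * M t)))"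
proof -
  have "3 \<le> Suc t" "Suc t - 1 = t" "Suc t - 2 = t - 1" using assms by auto
  then show ?thesis using eta_rule[of "Suc t"] by (simp only:)
qed

text \<open>
  By the last entry of the minimum, the ratio \<open>4 \<mu> \<eta>\<^sub>t M\<^sub>t\<^sub>-\<^sub>1 / \<tau>\<^sub>t\<^sub>-\<^sub>1\<close> in the rule for \<open>\<tau>\<close> lies between
  0 and 1. Each increment of \<open>\<tau>\<close> is therefore between \<open>\<alpha> \<mu> / 2\<close> and \<open>\<mu> / 2\<close>.
\<close>

lemma growth:
  assumes "2 \<le> t"
  shows "0 < \<eta> t \<and> \<mu> * (1 + \<alpha> * (real t - 2) / 2) \<le> \<tau> t \<and> \<tau> t \<le> \<mu> * (1 + (real t - 2) / 2) \<and>
    (\<forall>s. 1 \<le> s \<longrightarrow> s \<le> t \<longrightarrow> 0 \<le> \<tau> s) \<and> (2 < t \<longrightarrow> \<tau> t \<le> \<tau> (t - 1) + \<mu> / 2)"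
  using assms
proof (induction t rule: dec_induct)
  case base
  have "0 \<le> \<tau> s" if "1 \<le> s" "s \<le> 2" for s
  proof -
    have "s = 1 \<or> s = 2" using that by auto
    then show ?thesis using tau_1 tau_2 mu by auto
  qed
  then show ?case using eta_2_facts(4) tau_1 tau_2 by simp
next
  case (step t)
  have M: "0 \<le> M t" using M_nonneg[of t] step by simp
  have "0 \<le> \<mu> * (\<alpha> * (real t - 2) / 2)" using mu alpha step(1) by simp
  moreover have "\<mu> * (1 + \<alpha> * (real t - 2) / 2) \<le> \<tau> t" using step(3) by blast
  ultimately have mu_le: "\<mu> \<le> \<tau> t" by (simp add: distrib_left)
  have tau: "0 < \<tau> t" using mu mu_le by simp
  have q: "0 \<le> 4 * \<mu> * M t" using mu M by simp
  note f = ereal_min_division_cases[OF eta_Suc[OF step(1)] tau q]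
  have eta_t: "0 < \<eta> t" and nonneg: "\<And>s. 1 \<le> s \<Longrightarrow> s \<le> t \<Longrightarrow> 0 \<le> \<tau> s"
    using step.IH by blast+
  have "0 \<le> \<tau> (t - 1)" using nonneg[of "t - 1"] step(1) by linarith
  then have "0 < (\<tau> (t - 1) + \<mu>) / \<tau> t * \<eta> t" using tau mu eta_t by simp
  moreover have "0 < \<eta> (Suc t)" if "\<eta> (Suc t) * (4 * \<mu> * M t) = \<tau> t"
    using that tau q by (metis not_le mult_nonpos_nonneg)
  ultimately have eta: "0 < \<eta> (Suc t)" using f(4) eta_t by (elim disjE) auto
  define r where "r = \<eta> (Suc t) * (4 * \<mu> * M t / \<tau> t)"
  have r: "0 \<le> r" "r \<le> 1"
    using f(3) tau q eta by (auto simp: r_def)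
  have "\<tau> (Suc t) = \<tau> t + \<mu> / 2 * (\<alpha> + (1 - \<alpha>) * r)"
    using tau_rule[of "Suc t"] step(1) by (simp add: r_def mult.assoc)
  moreover have "\<mu> / 2 * \<alpha> \<le> \<mu> / 2 * (\<alpha> + (1 - \<alpha>) * r)" "\<mu> / 2 * (\<alpha> + (1 - \<alpha>) * r) \<le> \<mu> / 2 * 1"
    using mu alpha r mult_left_le[of r "1 - \<alpha>"] by (auto intro!: mult_left_mono)
  ultimately have d: "\<tau> t + \<mu> * \<alpha> / 2 \<le> \<tau> (Suc t)" "\<tau> (Suc t) \<le> \<tau> t + \<mu> / 2" by auto
  have "0 \<le> \<mu> * \<alpha> / 2" using mu alpha by simp
  then have "0 \<le> \<tau> (Suc t)" using d tau by linarith
  then have sgn: "\<forall>s. 1 \<le> s \<longrightarrow> s \<le> Suc t \<longrightarrow> 0 \<le> \<tau> s"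
    using nonneg by (auto simp: le_Suc_eq)
  have "\<mu> * (1 + \<alpha> * (real t - 2) / 2) \<le> \<tau> t" "\<tau> t \<le> \<mu> * (1 + (real t - 2) / 2)"
    using step.IH by blast+
  moreover have "\<mu> * (1 + \<alpha> * (real (Suc t) - 2) / 2) = \<mu> * (1 + \<alpha> * (real t - 2) / 2) + \<mu> * \<alpha> / 2"
    "\<mu> * (1 + (real (Suc t) - 2) / 2) = \<mu> * (1 + (real t - 2) / 2) + \<mu> / 2"
    by (simp_all add: field_simps)
  ultimately show ?case using eta d sgn step(1) by auto
qed

lemma eta_pos: "1 \<le> t \<Longrightarrow> 0 < \<eta> t"
  using growth[of t] eta_1 by (cases "t = 1") auto

lemma tau_nonneg: "1 \<le> t \<Longrightarrow> 0 \<le> \<tau> t"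
  using growth[of t] tau_1 by (cases "t = 1") auto

lemma tau_ge:
  assumes "2 \<le> t"
  shows "\<mu> \<le> \<tau> t"
proof -
  have "0 \<le> \<mu> * (\<alpha> * (real t - 2) / 2)" using mu alpha assms by simp
  moreover have "\<mu> * (1 + \<alpha> * (real t - 2) / 2) \<le> \<tau> t" using growth[OF assms] by blast
  ultimately show ?thesis by (simp add: distrib_left)
qed

lemma M_nonneg': "1 \<le> t \<Longrightarrow> 0 \<le> M t"
  using M_nonneg[of t] tau_nonneg by simp

lemma eta_step:
  assumes "2 \<le> t"
  shows "\<eta> (t + 1) \<le> 4 / 3 * \<eta> t" "\<eta> (t + 1) * \<tau> t \<le> (\<tau> (t - 1) + \<mu>) * \<eta> t"
    "\<eta> (t + 1) * (4 * \<mu> * M t) \<le> \<tau> t"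
    "\<eta> (t + 1) = 4 / 3 * \<eta> t \<or> \<eta> (t + 1) * \<tau> t = (\<tau> (t - 1) + \<mu>) * \<eta> t
      \<or> \<eta> (t + 1) * (4 * \<mu> * M t) = \<tau> t"
proof -
  have tau: "0 < \<tau> t" using tau_ge[OF assms] mu by simp
  have q: "0 \<le> 4 * \<mu> * M t" using mu M_nonneg'[of t] assms by simp
  note f = ereal_min_division_cases[OF eta_Suc[OF assms] tau q]
  show "\<eta> (t + 1) \<le> 4 / 3 * \<eta> t" "\<eta> (t + 1) * \<tau> t \<le> (\<tau> (t - 1) + \<mu>) * \<eta> t"
    "\<eta> (t + 1) * (4 * \<mu> * M t) \<le> \<tau> t"
    "\<eta> (t + 1) = 4 / 3 * \<eta> t \<or> \<eta> (t + 1) * \<tau> t = (\<tau> (t - 1) + \<mu>) * \<eta> t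
      \<or> \<eta> (t + 1) * (4 * \<mu> * M t) = \<tau> t"
    using f tau by (simp_all add: pos_le_divide_eq eq_divide_eq)
qed

text \<open>
  The three entries of the minimum are treated separately; write \<open>p\<close> for the left-hand side at \<open>t\<close>.
  The factor \<open>4 / 3\<close> suffices since \<open>p \<ge> 3 \<ge> 3 \<alpha>\<close>. In the second entry the growth factor is,
  for \<open>t \<ge> 3\<close>, at least \<open>1 + \<mu> / (2 \<tau>\<^sub>t)\<close>, which the upper bound on \<open>\<tau>\<^sub>t\<close> compares with
  \<open>1 + \<alpha> / p\<close>. The third entry is handled by the lower bound on \<open>\<tau>\<^sub>t\<close>. The truncated difference
  \<open>t - 3\<close> makes the statement at \<open>t = 2\<close> as strong as at \<open>t = 3\<close>. This is what the induction has to
  start from, because the second entry for \<open>\<eta>\<^sub>3\<close> is \<open>\<eta>\<^sub>2\<close> itself.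
\<close>

lemma eta_lower_bound_truncated:
  fixes \<Lambda> :: "nat \<Rightarrow> real"
  assumes \<Lambda>: "\<And>t. 1 \<le> t \<Longrightarrow> 1 / (4 * (1 - \<beta>) * \<eta> 1) \<le> \<Lambda> t" "\<And>t. 1 \<le> t \<Longrightarrow> M t \<le> \<Lambda> t"
      "\<And>t. 1 \<le> t \<Longrightarrow> \<Lambda> t \<le> \<Lambda> (t + 1)"
    and t: "2 \<le> t"
  shows "3 + \<alpha> * real (t - 3) \<le> 12 * (\<eta> t * \<Lambda> (t - 1))"
  using t
proof (induction t rule: dec_induct)
  case base
  have "1 \<le> 4 * (\<eta> 2 * \<Lambda> 1)" using eta_2_facts(3)
  proof
    assume e: "\<eta> 2 = (1 - \<beta>) * \<eta> 1"
    have "0 < (1 - \<beta>) * \<eta> 1" using beta eta_1 by simp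
    then show ?thesis using \<Lambda>(1)[of 1] unfolding e by (simp add: field_simps)
  next
    assume "\<eta> 2 * (4 * M 1) = 1"
    moreover have "\<eta> 2 * M 1 \<le> \<eta> 2 * \<Lambda> 1"
      using eta_2_facts(4) \<Lambda>(2)[of 1] by (intro mult_left_mono) auto
    ultimately show ?thesis by simp
  qed
  then show ?case by (simp add: mult.commute)
next
  case (step t)
  have pos: "0 < \<eta> t" "0 < \<eta> (Suc t)" using eta_pos step(1) by auto
  have LM: "\<eta> (Suc t) * M t \<le> \<eta> (Suc t) * \<Lambda> t"
    using pos \<Lambda>(2)[of t] step(1) by (intro mult_left_mono) auto
  have "\<eta> t * \<Lambda> (t - 1) \<le> \<eta> t * \<Lambda> t"
    using pos \<Lambda>(3)[of "t - 1"] step(1) by (intro mult_left_mono) auto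
  moreover define p where "p = 3 + \<alpha> * real (t - 3)"
  ultimately have p: "3 \<le> p" "p \<le> 12 * (\<eta> t * \<Lambda> t)"
    using step.IH alpha by (auto simp: p_def)
  have tau: "0 < \<tau> t" using tau_ge[OF step(1)] mu by simp
  have "3 + \<alpha> * real (Suc t - 3) \<le> 12 * (\<eta> (Suc t) * \<Lambda> t)"
    using eta_step(4)[OF step(1)] unfolding Suc_eq_plus1[symmetric]
  proof (elim disjE)
    assume e: "\<eta> (Suc t) = 4 / 3 * \<eta> t"
    have "3 + \<alpha> * real (Suc t - 3) \<le> p + \<alpha>"
      using step(1) alpha by (cases "t = 2") (auto simp: p_def Suc_diff_le algebra_simps)
    also have "\<dots> \<le> 4 / 3 * p" using p(1) alpha by simp
    finally show ?thesis using p(2) unfolding e by (simp add: mult.commute)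
  next
    assume e: "\<eta> (Suc t) * \<tau> t = (\<tau> (t - 1) + \<mu>) * \<eta> t"
    show ?thesis
    proof (cases "t = 2")
      case True
      then have "\<eta> (Suc t) = \<eta> t" using e tau_1 tau_2 mu by simp
      then show ?thesis using p True by (simp add: p_def)
    next
      case False
      then have t: "3 \<le> t" using step(1) by simp
      have "\<alpha> * \<tau> t \<le> \<alpha> * (\<mu> * (1 + (real t - 2) / 2))"
        using growth[OF step(1)] alpha by (intro mult_left_mono) auto
      also have "\<dots> = \<mu> / 2 * (\<alpha> * real t)" by (simp add: field_simps)
      also have "\<dots> \<le> \<mu> / 2 * p"
        using t mu alpha by (intro mult_left_mono) (auto simp: p_def algebra_simps)
      finally have "\<tau> t * (p + \<alpha>) \<le> (\<tau> t + \<mu> / 2) * p" by (simp add: algebra_simps)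
      also have "\<dots> \<le> (\<tau> (t - 1) + \<mu>) * (12 * (\<eta> t * \<Lambda> t))"
      proof (intro mult_mono)
        show "\<tau> t + \<mu> / 2 \<le> \<tau> (t - 1) + \<mu>" using growth[OF step(1)] t by simp
        then show "0 \<le> \<tau> (t - 1) + \<mu>" using tau mu by linarith
      qed (use p in auto)
      also have "\<dots> = 12 * \<Lambda> t * (\<eta> (Suc t) * \<tau> t)" unfolding e by (simp add: mult_ac)
      also have "\<dots> = \<tau> t * (12 * (\<eta> (Suc t) * \<Lambda> t))" by (simp add: mult_ac)
      finally have "p + \<alpha> \<le> 12 * (\<eta> (Suc t) * \<Lambda> t)" using tau by simp
      then show ?thesis using t by (simp add: p_def Suc_diff_le algebra_simps)
    qed
  next
    assume e: "\<eta> (Suc t) * (4 * \<mu> * M t) = \<tau> t"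
    have "\<mu> * (1 + \<alpha> * (real t - 2) / 2) \<le> \<mu> * (4 * (\<eta> (Suc t) * M t))"
      using growth[OF step(1)] e by (simp add: mult_ac)
    then have "1 + \<alpha> * (real t - 2) / 2 \<le> 4 * (\<eta> (Suc t) * M t)" using mu by simp
    moreover have "0 \<le> \<alpha> * (real t - 2)" using alpha step(1) by simp
    moreover have "real (Suc t - 3) = real t - 2" using step(1) by (simp add: of_nat_diff)
    ultimately show ?thesis using LM by simp
  qed
  then show ?case by simp
qed

end

section \<open>Convergence rate of the auto-conditioned method\<close>

theorem corollary4p6:
  fixes X :: "(real^'n) set" and W :: "(real^'p) set"
    and K :: "real^'n^'m" and B :: "real^'p^'m" and b :: "real^'m"
    and F :: "real^'n \<Rightarrow> real" and gradF :: "real^'n \<Rightarrow> real^'n" and G :: "real^'p \<Rightarrow> real"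
    and L\<^sub>F :: real
    and xs :: "real^'n" and ws :: "real^'p" and ys :: "real^'m"
    and \<mu> \<alpha> \<beta> :: real and bt \<eta> \<tau> tt :: "nat \<Rightarrow> real"
    and x xbar xt :: "nat \<Rightarrow> real^'n" and w :: "nat \<Rightarrow> real^'p" and y :: "nat \<Rightarrow> real^'m"
  assumes X: "X \<noteq> {}" "closed X" "convex X"
    and W: "W \<noteq> {}" "closed W" "convex W"
    and G: "convex_on W G" "lsc_on W G"
    and F: "convex_on X F" "gradient_on X F gradF" "L\<^sub>F > 0" "smooth_ineq_on X F gradF L\<^sub>F"
    and opt: "optimal_solution X W F G K B b xs ws"
    and saddle: "saddle_point X W F G K B b xs ws ys"
    and iter: "aadmm_iteration X W gradF G K B b \<mu> bt \<eta> \<tau> tt x xbar xt w y"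
    and \<mu>: "\<mu> > 0"
    and \<alpha>: "0 < \<alpha>" "\<alpha> \<le> 1"
    and \<beta>: "0 < \<beta>" "\<beta> \<le> 1 - sqrt 6 / 3"
    and bt: "bt 1 = 0" "\<And>t. t \<ge> 2 \<Longrightarrow> bt t = \<beta>"
    and init: "\<eta> 1 > 0" "\<tau> 1 = 0" "\<tau> 2 = \<mu>" "tt 1 = 0" "tt 2 = 1"
    and \<eta>2: "ereal (\<eta> 2) =
        min (ereal ((1 - \<beta>) * \<eta> 1))
            (ereal 1 / ereal (4 * (LK_est K y 1)\<^sup>2 / \<mu> + 4 * LF_est F gradF xt 1))"
    and \<eta>: "\<And>t. t \<ge> 3 \<Longrightarrow> ereal (\<eta> t) =
        min (ereal (4 / 3 * \<eta> (t - 1)))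
          (min (ereal ((\<tau> (t - 2) + \<mu>) / \<tau> (t - 1) * \<eta> (t - 1)))
            (ereal (\<tau> (t - 1)) /
             ereal (4 * \<mu> * LF_est F gradF xt (t - 1) + 4 * (LK_est K y (t - 1))\<^sup>2)))"
    and \<tau>: "\<And>t. t \<ge> 3 \<Longrightarrow> \<tau> t =
        \<tau> (t - 1) + \<mu> / 2 *
          (\<alpha> + (1 - \<alpha>) * \<eta> t *
            ((4 * \<mu> * LF_est F gradF xt (t - 1) + 4 * (LK_est K y (t - 1))\<^sup>2) / \<tau> (t - 1)))"
    and tt: "\<And>t. t \<ge> 3 \<Longrightarrow> tt t = \<tau> t / \<mu>"
  shows "let LK = LK_est K y; LF = LF_est F gradF xt;
             Lt = L_tilde \<beta> (\<eta> 1) \<mu> LK LF;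
             xhat = ergodic_avg \<eta> x; what = ergodic_avg \<eta> w; yt = y_tilde \<mu> \<eta> \<tau> y;
             D = (norm (x 0 - xs))\<^sup>2 / \<beta>
               + \<eta> 2 * (5 * (LK 1)\<^sup>2 / (2 * \<mu>) + 5 * LF 1 / 2 - 1 / (2 * \<eta> 1))
                   * (norm (x 1 - x 0))\<^sup>2
         in (\<forall>t\<ge>2. \<eta> t \<ge> (3 + \<alpha> * (real t - 3)) / (12 * Lt (t - 1))) \<and>
            (\<forall>k\<ge>1.
               F (xhat k) + G (what k) - F xs - G ws
                 \<le> 12 * Lt k / (6 * real k + \<alpha> * real k * (real k - 3)) * max 0 D \<and>
               norm (K *v xhat k - B *v what k + b) \<le> \<mu> * norm (yt k) \<and>
               \<mu> * norm (yt k)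
                 \<le> 2 * \<mu> * norm ys
                   + 2 * sqrt (12 * \<mu> * Lt k / (6 * real k + \<alpha> * real k * (real k - 3)) * max 0 D))"
proof -
  define LK LF Lt where "LK = LK_est K y" and "LF = LF_est F gradF xt"
    and "Lt = L_tilde \<beta> (\<eta> 1) \<mu> LK LF"
  define M where "M t = (LK t)\<^sup>2 / \<mu> + LF t" for t
  define D where "D = (norm (x 0 - xs))\<^sup>2 / \<beta>
    + \<eta> 2 * (5 * (LK 1)\<^sup>2 / (2 * \<mu>) + 5 * LF 1 / 2 - 1 / (2 * \<eta> 1)) * (norm (x 1 - x 0))\<^sup>2"
  \<comment> \<open>\<open>(12 / 5)\<^sup>2 = 144 / 25 < 6\<close>\<close>
  have "12 / 5 \<le> sqrt 6" by (rule real_le_rsqrt) (simp add: power2_eq_square)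
  then have beta: "\<beta> \<le> 1 / 5" using \<beta>(2) by simp
  have tt_eq: "tt t = \<tau> t / \<mu>" if "1 \<le> t" for t
  proof -
    have "t = 1 \<or> t = 2 \<or> 3 \<le> t" using that by auto
    then show ?thesis using init tt \<mu> by auto
  qed
  have M_nonneg: "0 \<le> M t" if "\<And>s. 1 \<le> s \<Longrightarrow> s \<le> t \<Longrightarrow> 0 \<le> \<tau> s" for t
  proof -
    have "xt t \<in> X" "xt (t - 1) \<in> X"
      using that tt_eq \<mu> by (auto intro!: averaged_iterates_in_domain[OF iter X(3)])
    then have "0 \<le> LF t" unfolding LF_def by (rule LF_est_nonneg[OF F(4,3)])
    then show ?thesis using \<mu> by (simp add: M_def)
  qed
  have four_M: "4 * \<mu> * LF t + 4 * (LK t)\<^sup>2 = 4 * \<mu> * M t"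
    "4 * (LK t)\<^sup>2 / \<mu> + 4 * LF t = 4 * M t" for t
    using \<mu> by (simp_all add: M_def field_simps)
  interpret stepsizes: adaptive_stepsizes \<mu> \<alpha> \<beta> \<eta> \<tau> M
  proof
    show "\<beta> < 1" using beta by simp
    show "0 \<le> M t" if "\<And>s. 1 \<le> s \<Longrightarrow> s \<le> t \<Longrightarrow> 0 \<le> \<tau> s" for t
      using that by (rule M_nonneg)
  qed (use \<mu> \<alpha> init \<eta>2 \<eta> \<tau> in \<open>simp_all only: four_M LK_def[symmetric] LF_def[symmetric]\<close>)
  interpret ac_aadmm X W K B b F gradF G L\<^sub>F xs ws ys \<mu> \<beta> bt \<eta> \<tau> tt x xbar xt w y
  proof
    show "B *v ws - K *v xs = b"
      using opt by (simp add: optimal_solution_def is_arg_min_def)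
    show "\<eta> 2 * (4 * ((LK_est K y 1)\<^sup>2 / \<mu> + LF_est F gradF xt 1)) \<le> 1"
      using stepsizes.eta_2_facts(2) unfolding M_def LK_def LF_def .
    fix t :: nat
    assume t: "2 \<le> t"
    show "0 < \<tau> t" using stepsizes.tau_ge[OF t] \<mu> by simp
    have "4 * (\<mu> * LF t + (LK t)\<^sup>2) = 4 * \<mu> * M t" using four_M(1)[of t] by simp
    then show "\<eta> (t + 1) * (4 * (\<mu> * LF_est F gradF xt t + (LK_est K y t)\<^sup>2)) \<le> \<tau> t"
      using stepsizes.eta_step(3)[OF t] unfolding LK_def LF_def by simp
  qed (use X W G F saddle iter \<mu> \<beta> beta bt init tt_eq stepsizes.eta_pos stepsizes.eta_2_facts(1)
      stepsizes.eta_step in simp_all)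
  have Lt_eq: "Lt t = Max (insert (1 / (4 * (1 - \<beta>) * \<eta> 1)) (M ` {1..t}))" for t
    by (simp only: Lt_def L_tilde_def M_def[abs_def])
  have Lt_ge: "1 / (4 * (1 - \<beta>) * \<eta> 1) \<le> Lt t" for t
    unfolding Lt_eq by (rule Max_ge) auto
  have M_le: "M t \<le> Lt t" if "1 \<le> t" for t
    unfolding Lt_eq using that by (intro Max_ge) auto
  have Lt_mono: "Lt s \<le> Lt t" if "s \<le> t" for s t
    unfolding Lt_eq using that by (intro Max_mono) auto
  have Lt_pos: "0 < Lt t" for t
  proof -
    have "0 < 1 / (4 * (1 - \<beta>) * \<eta> 1)" using beta init(1) by simp
    then show ?thesis using Lt_ge[of t] by linarith
  qed
  have eta_Lt: "3 + \<alpha> * (real t - 3) \<le> 12 * (\<eta> t * Lt (t - 1))" if "2 \<le> t" for t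
  proof -
    have "3 + \<alpha> * (real t - 3) \<le> 3 + \<alpha> * real (t - 3)"
      using \<alpha> by (intro add_left_mono mult_left_mono) auto
    also have "\<dots> \<le> 12 * (\<eta> t * Lt (t - 1))"
      using Lt_ge M_le Lt_mono that by (intro stepsizes.eta_lower_bound_truncated) auto
    finally show ?thesis .
  qed
  have part1: "(3 + \<alpha> * (real t - 3)) / (12 * Lt (t - 1)) \<le> \<eta> t" if "2 \<le> t" for t
    using eta_Lt[OF that] Lt_pos[of "t - 1"] by (simp add: pos_divide_le_eq mult_ac)
  have part2: "F (ergodic_avg \<eta> x k) + G (ergodic_avg \<eta> w k) - F xs - G ws \<le> E \<and>
      norm (K *v ergodic_avg \<eta> x k - B *v ergodic_avg \<eta> w k + b) \<le> \<mu> * norm (y_tilde \<mu> \<eta> \<tau> y k) \<and>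
      \<mu> * norm (y_tilde \<mu> \<eta> \<tau> y k) \<le> 2 * \<mu> * norm ys + 2 * sqrt (\<mu> * E)"
    if k: "1 \<le> k" and E: "E = 12 * Lt k / (6 * real k + \<alpha> * real k * (real k - 3)) * max 0 D"
    for k E
  proof -
    define q where "q = 6 * real k + \<alpha> * real k * (real k - 3)"
    have "\<alpha> * (-2) \<le> \<alpha> * (real k - 3)" using \<alpha> k by (intro mult_left_mono) auto
    then have "0 < real k * (6 + \<alpha> * (real k - 3))" using k \<alpha> by (intro mult_pos_pos) auto
    then have q: "0 < q" by (simp add: q_def algebra_simps)
    \<comment> \<open>the lower bounds on the step sizes, summed over \<open>t\<close>, are an arithmetic progression\<close>
    have "q / 2 = (\<Sum>t=1..k. 3 + \<alpha> * (real (t + 1) - 3))"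
      unfolding q_def using k by (induction k rule: dec_induct) (auto simp: field_simps)
    also have "\<dots> \<le> (\<Sum>t=1..k. 12 * Lt k * \<eta> (t + 1))"
    proof (rule sum_mono)
      fix t assume t: "t \<in> {1..k}"
      have "3 + \<alpha> * (real (t + 1) - 3) \<le> 12 * (\<eta> (t + 1) * Lt t)" using eta_Lt[of "t + 1"] t by simp
      also have "\<dots> \<le> 12 * (\<eta> (t + 1) * Lt k)"
        using Lt_mono[of t k] t stepsizes.eta_pos[of "t + 1"] by (intro mult_left_mono) auto
      finally show "3 + \<alpha> * (real (t + 1) - 3) \<le> 12 * Lt k * \<eta> (t + 1)" by (simp add: mult_ac)
    qed
    also have "\<dots> = 12 * Lt k * total_stepsize k" by (simp add: total_stepsize_def sum_distrib_left)
    finally have q_le: "q / 2 \<le> 12 * Lt k * total_stepsize k" .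
    have "D / 2 \<le> 1 / 2 * max 0 D" by simp
    also have "\<dots> \<le> 12 * Lt k * total_stepsize k / q * max 0 D"
      using q q_le by (intro mult_right_mono) (auto simp: pos_le_divide_eq)
    also have "\<dots> = total_stepsize k * E" by (simp add: E q_def)
    finally have DE: "D / 2 \<le> total_stepsize k * E" .
    have "D / 2 = 1 / (2 * \<beta>) * (norm (x 0 - xs))\<^sup>2
      + \<eta> 2 * (5 / 4 * ((LK 1)\<^sup>2 / \<mu> + LF 1) - 1 / (4 * \<eta> 1)) * (norm (x 1 - x 0))\<^sup>2"
      by (simp add: D_def add_divide_distrib diff_divide_distrib algebra_simps)
    then have "1 / (2 * \<beta>) * (norm (x 0 - xs))\<^sup>2
      + \<eta> 2 * (5 / 4 * ((LK_est K y 1)\<^sup>2 / \<mu> + LF_est F gradF xt 1) - 1 / (4 * \<eta> 1))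
        * (norm (x 1 - x 0))\<^sup>2 \<le> total_stepsize k * E"
      using DE by (simp only: LK_def LF_def)
    moreover have "0 \<le> E" unfolding E q_def[symmetric] using q Lt_pos[of k] by simp
    ultimately show ?thesis using ergodic_convergence[OF k] by simp
  qed
  show ?thesis
    unfolding Let_def LK_def[symmetric] LF_def[symmetric] Lt_def[symmetric] D_def[symmetric]
  proof (intro conjI allI impI)
    show "(3 + \<alpha> * (real t - 3)) / (12 * Lt (t - 1)) \<le> \<eta> t" if "2 \<le> t" for t
      using that by (rule part1)
    fix k :: nat
    assume k: "1 \<le> k"
    define E where "E = 12 * Lt k / (6 * real k + \<alpha> * real k * (real k - 3)) * max 0 D"
    note bounds = part2[OF k E_def]
    show "F (ergodic_avg \<eta> x k) + G (ergodic_avg \<eta> w k) - F xs - G ws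
        \<le> 12 * Lt k / (6 * real k + \<alpha> * real k * (real k - 3)) * max 0 D"
      using bounds unfolding E_def by blast
    show "norm (K *v ergodic_avg \<eta> x k - B *v ergodic_avg \<eta> w k + b) \<le> \<mu> * norm (y_tilde \<mu> \<eta> \<tau> y k)"
      using bounds by blast
    have "\<mu> * E = 12 * \<mu> * Lt k / (6 * real k + \<alpha> * real k * (real k - 3)) * max 0 D"
      by (simp add: E_def)
    then show "\<mu> * norm (y_tilde \<mu> \<eta> \<tau> y k) \<le> 2 * \<mu> * norm ys
        + 2 * sqrt (12 * \<mu> * Lt k / (6 * real k + \<alpha> * real k * (real k - 3)) * max 0 D)"
      using bounds by simp
  qed
qed

end
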